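(* Let $M=\Gamma\backslash G$ be a $2$-step nilmanifold of real dimension $6$ with first Betti number $b_1\geq 4$, and let $J$ be an invariant non-parallelizable complex structure on $M$; put $X=(M,J)$. Then each of the following flows of invariant metrics on $X$ preserves the balanced condition, i.e. if $d(\omega_0^2)=0$ then $d(\omega_t^2)=0$ for all $t$ in the interval of existence: (F1) $\partial_t(\Vert\Psi\Vert_{\omega_t}\omega_t^2)= i\partial\overline\partial\omega_t-\frac{\alpha'}{4}\big(\mathrm{Tr}(Rm^\tau_t\wedge Rm^\tau_t)-\mathrm{Tr}(A^\kappa_t\wedge A^\kappa_t)\big)$, $\quad H_t^{-1}\partial_t H_t=\frac{\omega_t^2\wedge A_t^\kappa}{\omega_t^3}$, where $\mathrm{Tr}(A_t^\kappa\wedge A_t^\kappa)$ is, for every $t$, a multiple of the $(2,2)$-form $\zeta^{12\bar1\bar2}$; (F2) $\partial_t(\Vert\Psi\Vert_{\omega_t}\omega_t^2)= i\partial\overline\partial\omega_t-\frac{\alpha'}{4}\mathrm{Tr}(Rm^\tau_t\wedge Rm^\tau_t)$.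
   Context: All structures are invariant, i.e. induced by left-invariant ones on the $2$-step nilpotent Lie group $G$; $\Gamma$ is a co-compact lattice. "Non-parallelizable" means $(G,J)$ is not a complex Lie group. Notation: $\zeta^{i\bar j}=\zeta^i\wedge\overline{\zeta^j}$, $\zeta^{12\bar1\bar2}=\zeta^1\wedge\zeta^2\wedge\overline{\zeta^1}\wedge\overline{\zeta^2}$. Under these hypotheses there is a left-invariant $(1,0)$-coframe $\{\zeta^1,\zeta^2,\zeta^3\}$ with $d\zeta^1=d\zeta^2=0$, $d\zeta^3=\rho\,\zeta^{12}+\zeta^{1\bar1}+\lambda\,\zeta^{1\bar2}+(x+iy)\,\zeta^{2\bar2}$, where $x,y,\lambda\in\mathbb R$, $\lambda\ge0$, $\rho\in\{0,1\}$. Fix one and let $\Psi=\zeta^1\wedge\zeta^2\wedge\zeta^3$. For $\omega=\frac i2\sum h_{j\bar l}\,\zeta^{j\bar l}$ with $(h_{j\bar l})$ positive definite Hermitian, $\Vert\Psi\Vert_\omega^2=8/\det(h_{j\bar l})$. $Rm^\tau_t$ is the curvature of the Gauduchon connection $\nabla^\tau$ of $\omega_t$, where $\nabla^\tau=\frac{1+\tau}2\nabla^1+\frac{1-\tau}2\nabla^{-1}$, $\nabla^1$ being the Chern connection and $\nabla^{-1}$ the Strominger–Bismut connection (the Hermitian connection with totally skew torsion); $\mathrm{Tr}(\Omega\wedge\Omega)=\sum_{i<j}\Omega^i_j\wedge\Omega^i_j$ in a real orthonormal frame. In (F1), $H_t$ is an invariant Hermitian metric on a holomorphic vector bundle $E\to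 X$ and $A_t^\kappa$ the curvature of a Gauduchon connection $\nabla^\kappa$ on $(E,H_t)$. $\alpha',\tau,\kappa\in\mathbb R$ are constants. *)

theory Defs
  imports "HOL-Homology.Homology" "HOL-Analysis.Analysis" "HOL-Library.Extended_Nat"
begin

text \<open>
  The simply connected 2-step nilpotent Lie group \<open>G\<close> is given by its Lie algebra \<open>'g\<close> with bracket
  \<open>br\<close>.  Invariant tensors on \<open>\<Gamma>\<backslash>G\<close> are the corresponding tensors on \<open>'g\<close>; the Euclidean structure
  of \<open>'g\<close> serves only to provide the vector space topology.
\<close>

section \<open>Nilmanifolds\<close>

definition lie_bracket :: "('g::euclidean_space \<Rightarrow> 'g \<Rightarrow> 'g) \<Rightarrow> bool" where
  "lie_bracket br \<longleftrightarrow> bilinear br \<and> (\<forall>x. br x x = 0) \<and>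
     (\<forall>x y z. br x (br y z) + br y (br z x) + br z (br x y) = 0)"

definition two_step_nilpotent :: "('g::euclidean_space \<Rightarrow> 'g \<Rightarrow> 'g) \<Rightarrow> bool" where
  "two_step_nilpotent br \<longleftrightarrow> lie_bracket br \<and>
     (\<forall>x y z. br x (br y z) = 0) \<and> (\<exists>x y. br x y \<noteq> 0)"

text \<open>In exponential coordinates the Baker--Campbell--Hausdorff series stops after the first bracket.\<close>

definition nil_group :: "('g::euclidean_space \<Rightarrow> 'g \<Rightarrow> 'g) \<Rightarrow> 'g monoid" where
  "nil_group br = \<lparr>carrier = UNIV, monoid.mult = (\<lambda>x y. x + y + (1/2) *\<^sub>R br x y), monoid.one = 0\<rparr>"

text \<open>\<open>\<Gamma>\<backslash>G\<close> with the quotient topology; its points are the cosets \<open>\<Gamma>x\<close>.\<close>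

definition nilmanifold :: "('g::euclidean_space \<Rightarrow> 'g \<Rightarrow> 'g) \<Rightarrow> 'g set \<Rightarrow> 'g set topology" where
  "nilmanifold br \<Gamma> = topology (\<lambda>U. U \<subseteq> rcosets\<^bsub>nil_group br\<^esub> \<Gamma> \<and> open (\<Union>U))"

definition cocompact_lattice :: "('g::euclidean_space \<Rightarrow> 'g \<Rightarrow> 'g) \<Rightarrow> 'g set \<Rightarrow> bool" where
  "cocompact_lattice br \<Gamma> \<longleftrightarrow> subgroup \<Gamma> (nil_group br) \<and>
     subtopology euclidean \<Gamma> = discrete_topology \<Gamma> \<and> compact_space (nilmanifold br \<Gamma>)"

text \<open>The Betti number is the rank of integral singular homology, i.e. the supremum of the sizes of
  finite \<open>\<int>\<close>-independent subsets.\<close>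

definition int_independent :: "('a, 'b) monoid_scheme \<Rightarrow> 'a set \<Rightarrow> bool" where
  "int_independent A S \<longleftrightarrow> S \<subseteq> carrier A \<and>
     (\<forall>n :: 'a \<Rightarrow> int. finprod A (\<lambda>s. s [^]\<^bsub>A\<^esub> n s) S = \<one>\<^bsub>A\<^esub> \<longrightarrow> (\<forall>s\<in>S. n s = 0))"

definition betti :: "nat \<Rightarrow> 'a topology \<Rightarrow> enat" where
  "betti p X = (SUP S \<in> {S. finite S \<and> int_independent (homology_group (int p) X) S}. enat (card S))"

section \<open>Invariant complex-valued differential forms\<close>

text \<open>A form is a function on argument lists; a form of degree \<open>k\<close> is zero on lists of length other
  than \<open>k\<close>.\<close>

type_synonym 'g form = "'g list \<Rightarrow> complex"

definition unit_form :: "'g form" where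
  "unit_form xs = (if xs = [] then 1 else 0)"

definition conj_form :: "'g form \<Rightarrow> 'g form" where
  "conj_form \<alpha> xs = cnj (\<alpha> xs)"

definition form2 :: "('g \<Rightarrow> 'g \<Rightarrow> complex) \<Rightarrow> 'g form" where
  "form2 f xs = (if length xs = 2 then f (xs ! 0) (xs ! 1) else 0)"

text \<open>Sum over all shuffles: the arguments in the positions \<open>A\<close> go to \<open>\<alpha>\<close>, the others to \<open>\<beta>\<close>.  The
  exponent counts the inversions of the shuffle, so that
  \<open>(\<alpha> \<and> \<beta>)(x, y) = \<alpha>(x) \<beta>(y) - \<alpha>(y) \<beta>(x)\<close> in degree one.\<close>

definition wedge :: "'g form \<Rightarrow> 'g form \<Rightarrow> 'g form"  (infixr \<open>\<and>\<^sub>f\<close> 75) where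
  "(\<alpha> \<and>\<^sub>f \<beta>) xs = (\<Sum>A \<in> Pow {..<length xs}.
     (-1) ^ card {(i, j). i \<in> A \<and> j < i \<and> j \<notin> A} * \<alpha> (nths xs A) * \<beta> (nths xs (- A)))"

definition wedge_list :: "'g form list \<Rightarrow> 'g form" where
  "wedge_list \<alpha>s = foldr wedge \<alpha>s unit_form"

text \<open>The exterior derivative on left-invariant forms: all summands of the Cartan formula which
  differentiate a coefficient function vanish.\<close>

definition ext_d :: "('g \<Rightarrow> 'g \<Rightarrow> 'g) \<Rightarrow> 'g form \<Rightarrow> 'g form" where
  "ext_d br \<alpha> xs = (\<Sum>(i, j) \<in> {(i, j). i < j \<and> j < length xs}.
     (-1) ^ (i + j) * \<alpha> (br (xs ! i) (xs ! j) # nths xs (- {i, j})))"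

section \<open>Invariant complex structures\<close>

definition complex_structure ::
  "('g::euclidean_space \<Rightarrow> 'g \<Rightarrow> 'g) \<Rightarrow> ('g \<Rightarrow> 'g) \<Rightarrow> bool" where
  "complex_structure br J \<longleftrightarrow> linear J \<and> (\<forall>x. J (J x) = - x) \<and>
     (\<forall>x y. br (J x) (J y) - J (br (J x) y) - J (br x (J y)) - br x y = 0)"

text \<open>\<open>(G, J)\<close> is a complex Lie group.\<close>

definition complex_parallelizable ::
  "('g::euclidean_space \<Rightarrow> 'g \<Rightarrow> 'g) \<Rightarrow> ('g \<Rightarrow> 'g) \<Rightarrow> bool" where
  "complex_parallelizable br J \<longleftrightarrow> (\<forall>x y. br (J x) y = J (br x y))"

definition forms10 :: "('g::euclidean_space \<Rightarrow> 'g) \<Rightarrow> 'g form set" where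
  "forms10 J = {\<alpha>. linear (\<lambda>x. \<alpha> [x]) \<and> (\<forall>x. \<alpha> [J x] = \<i> * \<alpha> [x]) \<and>
     (\<forall>xs. length xs \<noteq> 1 \<longrightarrow> \<alpha> xs = 0)}"

text \<open>\<open>\<Lambda>\<^bsup>p,q\<^esup>\<close>: the complex span of the products of \<open>p\<close> forms of type \<open>(1,0)\<close> and \<open>q\<close> conjugates of
  such forms.\<close>

inductive_set forms_pq :: "('g::euclidean_space \<Rightarrow> 'g) \<Rightarrow> nat \<Rightarrow> nat \<Rightarrow> 'g form set"
  for J p q where
  zero: "(\<lambda>_. 0) \<in> forms_pq J p q"
| add: "\<alpha> \<in> forms_pq J p q \<Longrightarrow> length as = p \<Longrightarrow> length bs = q \<Longrightarrow>
    set as \<subseteq> forms10 J \<Longrightarrow> set bs \<subseteq> forms10 J \<Longrightarrow>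
    (\<lambda>xs. \<alpha> xs + c * wedge_list (as @ map conj_form bs) xs) \<in> forms_pq J p q"

text \<open>On forms of type \<open>(p,q)\<close> one has \<open>d = \<partial> + \<partial>bar\<close>, with \<open>\<partial>\<close> and \<open>\<partial>bar\<close> of type \<open>(p+1,q)\<close> and
  \<open>(p,q+1)\<close>.\<close>

definition del ::
  "('g::euclidean_space \<Rightarrow> 'g \<Rightarrow> 'g) \<Rightarrow> ('g \<Rightarrow> 'g) \<Rightarrow> nat \<Rightarrow> nat \<Rightarrow> 'g form \<Rightarrow> 'g form" where
  "del br J p q \<alpha> = (THE \<beta>. \<beta> \<in> forms_pq J (p + 1) q \<and>
     (\<exists>\<gamma> \<in> forms_pq J p (q + 1). ext_d br \<alpha> = (\<lambda>xs. \<beta> xs + \<gamma> xs)))"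

definition delbar ::
  "('g::euclidean_space \<Rightarrow> 'g \<Rightarrow> 'g) \<Rightarrow> ('g \<Rightarrow> 'g) \<Rightarrow> nat \<Rightarrow> nat \<Rightarrow> 'g form \<Rightarrow> 'g form" where
  "delbar br J p q \<alpha> = (THE \<gamma>. \<gamma> \<in> forms_pq J p (q + 1) \<and>
     (\<exists>\<beta> \<in> forms_pq J (p + 1) q. ext_d br \<alpha> = (\<lambda>xs. \<beta> xs + \<gamma> xs)))"

definition coframe :: "('g::euclidean_space \<Rightarrow> 'g) \<Rightarrow> ('n::finite \<Rightarrow> 'g form) \<Rightarrow> bool" where
  "coframe J \<zeta> \<longleftrightarrow> (\<forall>j. \<zeta> j \<in> forms10 J) \<and>
     (\<forall>\<alpha> \<in> forms10 J. \<exists>!c. \<alpha> = (\<lambda>xs. \<Sum>j\<in>UNIV. c j * \<zeta> j xs))"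

section \<open>Hermitian metrics\<close>

definition pos_def_hermitian :: "complex^'n^'n \<Rightarrow> bool" where
  "pos_def_hermitian h \<longleftrightarrow> (\<forall>j l. h $ l $ j = cnj (h $ j $ l)) \<and>
     (\<forall>v. v \<noteq> 0 \<longrightarrow> Re (\<Sum>j\<in>UNIV. \<Sum>l\<in>UNIV. h $ j $ l * v $ j * cnj (v $ l)) > 0)"

text \<open>\<open>\<omega> = \<i>/2 \<Sum> h\<^sub>j\<^sub>l \<zeta>\<^sup>j \<and> conj \<zeta>\<^sup>l\<close>\<close>

definition fund_form :: "('n::finite \<Rightarrow> 'g form) \<Rightarrow> complex^'n^'n \<Rightarrow> 'g form" where
  "fund_form \<zeta> h xs =
     \<i> / 2 * (\<Sum>j\<in>UNIV. \<Sum>l\<in>UNIV. h $ j $ l * (\<zeta> j \<and>\<^sub>f conj_form (\<zeta> l)) xs)"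

text \<open>The Riemannian metric \<open>g(x, y) = \<omega>(x, J y)\<close>\<close>

definition metric_of :: "('g \<Rightarrow> 'g) \<Rightarrow> 'g form \<Rightarrow> 'g \<Rightarrow> 'g \<Rightarrow> real" where
  "metric_of J \<omega> x y = Re (\<omega> [x, J y])"

text \<open>The norm of \<open>\<Psi> = \<zeta>\<^sup>1 \<and> \<zeta>\<^sup>2 \<and> \<zeta>\<^sup>3\<close> with respect to \<open>fund_form \<zeta> h\<close>; the determinant is a
  positive real number.\<close>

definition norm_Psi :: "complex^3^3 \<Rightarrow> real" where
  "norm_Psi h = sqrt (8 / Re (det h))"

definition balanced :: "('g \<Rightarrow> 'g \<Rightarrow> 'g) \<Rightarrow> 'g form \<Rightarrow> bool" where
  "balanced br \<omega> \<longleftrightarrow> ext_d br (\<omega> \<and>\<^sub>f \<omega>) = (\<lambda>_. 0)"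

section \<open>Connections and curvature\<close>

text \<open>Here \<open>D x y\<close> is the covariant derivative of the left-invariant field \<open>y\<close> along \<open>x\<close>.\<close>

definition torsion :: "('g::euclidean_space \<Rightarrow> 'g \<Rightarrow> 'g) \<Rightarrow> ('g \<Rightarrow> 'g \<Rightarrow> 'g) \<Rightarrow> 'g \<Rightarrow> 'g \<Rightarrow> 'g" where
  "torsion br D x y = D x y - D y x - br x y"

definition hermitian_connection ::
  "('g::euclidean_space \<Rightarrow> 'g) \<Rightarrow> ('g \<Rightarrow> 'g \<Rightarrow> real) \<Rightarrow> ('g \<Rightarrow> 'g \<Rightarrow> 'g) \<Rightarrow> bool" where
  "hermitian_connection J g D \<longleftrightarrow> bilinear D \<and>
     (\<forall>x y z. g (D x y) z + g y (D x z) = 0) \<and> (\<forall>x y. D x (J y) = J (D x y))"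

text \<open>The Chern connection is the Hermitian connection whose torsion has no \<open>(1,1)\<close>-component.\<close>

definition chern_connection :: "('g::euclidean_space \<Rightarrow> 'g \<Rightarrow> 'g) \<Rightarrow> ('g \<Rightarrow> 'g) \<Rightarrow>
    ('g \<Rightarrow> 'g \<Rightarrow> real) \<Rightarrow> ('g \<Rightarrow> 'g \<Rightarrow> 'g) \<Rightarrow> bool" where
  "chern_connection br J g D \<longleftrightarrow> hermitian_connection J g D \<and>
     (\<forall>x y. torsion br D x y + torsion br D (J x) (J y) = 0)"

definition bismut_connection :: "('g::euclidean_space \<Rightarrow> 'g \<Rightarrow> 'g) \<Rightarrow> ('g \<Rightarrow> 'g) \<Rightarrow>
    ('g \<Rightarrow> 'g \<Rightarrow> real) \<Rightarrow> ('g \<Rightarrow> 'g \<Rightarrow> 'g) \<Rightarrow> bool" where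
  "bismut_connection br J g D \<longleftrightarrow> hermitian_connection J g D \<and>
     (\<forall>x y z. g (torsion br D x y) z = - g (torsion br D x z) y)"

definition gauduchon_connection :: "('g::euclidean_space \<Rightarrow> 'g \<Rightarrow> 'g) \<Rightarrow> ('g \<Rightarrow> 'g) \<Rightarrow>
    ('g \<Rightarrow> 'g \<Rightarrow> real) \<Rightarrow> real \<Rightarrow> ('g \<Rightarrow> 'g \<Rightarrow> 'g) \<Rightarrow> bool" where
  "gauduchon_connection br J g \<tau> D \<longleftrightarrow>
     (\<exists>D1 D2. chern_connection br J g D1 \<and> bismut_connection br J g D2 \<and>
        (\<forall>x y. D x y = ((1 + \<tau>) / 2) *\<^sub>R D1 x y + ((1 - \<tau>) / 2) *\<^sub>R D2 x y))"

definition curvature :: "('g::euclidean_space \<Rightarrow> 'g \<Rightarrow> 'g) \<Rightarrow> ('g \<Rightarrow> 'g \<Rightarrow> 'g) \<Rightarrow>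
    'g \<Rightarrow> 'g \<Rightarrow> 'g \<Rightarrow> 'g" where
  "curvature br D x y v = D x (D y v) - D y (D x v) - D (br x y) v"

definition orthonormal_frame :: "('v::euclidean_space \<Rightarrow> 'v \<Rightarrow> real) \<Rightarrow> (nat \<Rightarrow> 'v) \<Rightarrow> bool" where
  "orthonormal_frame \<gamma> e \<longleftrightarrow>
     (\<forall>i<DIM('v). \<forall>j<DIM('v). \<gamma> (e i) (e j) = (if i = j then 1 else 0))"

text \<open>\<open>Tr(\<Omega> \<and> \<Omega>)\<close> for the curvature \<open>R\<close> of a connection on a bundle with typical fibre \<open>'v\<close>, fibre
  metric \<open>\<gamma>\<close> and real orthonormal frame \<open>e\<close>, where \<open>\<Omega>\<^sup>i\<^sub>j(x, y) = \<gamma>(R(x, y) e\<^sub>j, e\<^sub>i)\<close>.\<close>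

definition trace_square :: "('v::euclidean_space \<Rightarrow> 'v \<Rightarrow> real) \<Rightarrow> (nat \<Rightarrow> 'v) \<Rightarrow>
    ('g \<Rightarrow> 'g \<Rightarrow> 'v \<Rightarrow> 'v) \<Rightarrow> 'g form" where
  "trace_square \<gamma> e R xs =
     (let \<Omega> = (\<lambda>i j. form2 (\<lambda>x y. complex_of_real (\<gamma> (R x y (e j)) (e i))))
      in \<Sum>j<DIM('v). \<Sum>i<j. (\<Omega> i j \<and>\<^sub>f \<Omega> i j) xs)"

section \<open>Invariant holomorphic vector bundles\<close>

text \<open>
  An invariant holomorphic vector bundle \<open>E\<close> has a left-invariant frame \<open>(s\<^sub>a)\<close>.  Its
  holomorphic structure is \<open>\<partial>bar s\<^sub>b = \<Sum>\<^sub>a \<theta>\<^sup>a\<^sub>b s\<^sub>a\<close>, and a connection is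
  \<open>\<nabla> s\<^sub>b = \<Sum>\<^sub>a \<sigma>\<^sup>a\<^sub>b s\<^sub>a\<close>.
\<close>

definition holomorphic_structure :: "('g::euclidean_space \<Rightarrow> 'g \<Rightarrow> 'g) \<Rightarrow> ('g \<Rightarrow> 'g) \<Rightarrow>
    ('r::finite \<Rightarrow> 'r \<Rightarrow> 'g form) \<Rightarrow> bool" where
  "holomorphic_structure br J \<theta> \<longleftrightarrow> (\<forall>a b. \<theta> a b \<in> forms_pq J 0 1) \<and>
     (\<forall>a b xs. delbar br J 0 1 (\<theta> a b) xs + (\<Sum>c\<in>UNIV. (\<theta> a c \<and>\<^sub>f \<theta> c b) xs) = 0)"

text \<open>A Hermitian metric on \<open>E\<close> is a matrix \<open>H\<close> with \<open>\<langle>u, v\<rangle> = v\<^sup>* H u\<close>, so that \<open>H\<^sup>-\<^sup>1 \<partial>\<^sub>t H\<close> is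
  the matrix of an endomorphism.\<close>

definition bundle_metric :: "complex^'r^'r \<Rightarrow> complex^'r \<Rightarrow> complex^'r \<Rightarrow> real" where
  "bundle_metric H u v = Re (\<Sum>a\<in>UNIV. \<Sum>b\<in>UNIV. cnj (v $ a) * H $ a $ b * u $ b)"

definition conn_matrix :: "('r \<Rightarrow> 'r \<Rightarrow> 'g form) \<Rightarrow> 'g \<Rightarrow> complex^'r^'r" where
  "conn_matrix \<sigma> x = (\<chi> a b. \<sigma> a b [x])"

definition adjoint_matrix :: "complex^'r^'r \<Rightarrow> complex^'r^'r" where
  "adjoint_matrix A = (\<chi> a b. cnj (A $ b $ a))"

definition bundle_chern_connection :: "('g::euclidean_space \<Rightarrow> 'g) \<Rightarrow>
    ('r::finite \<Rightarrow> 'r \<Rightarrow> 'g form) \<Rightarrow> complex^'r^'r \<Rightarrow> ('r \<Rightarrow> 'r \<Rightarrow> 'g form) \<Rightarrow> bool" where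
  "bundle_chern_connection J \<theta> H \<sigma> \<longleftrightarrow>
     (\<forall>a b. (\<lambda>xs. \<sigma> a b xs - \<theta> a b xs) \<in> forms10 J) \<and>
     (\<forall>x. H ** conn_matrix \<sigma> x + adjoint_matrix (conn_matrix \<sigma> x) ** H = 0)"

text \<open>
  \<open>E\<close> is the holomorphic tangent bundle \<open>T\<^sup>1\<^sup>,\<^sup>0X\<close>, with \<open>(s\<^sub>a)\<close> the frame dual to the coframe \<open>\<eta>\<close>.
  Under \<open>v \<mapsto> (v - \<i> J v)/2\<close> the operator \<open>\<partial>bar\<^sub>x Z = [x\<^sup>0\<^sup>,\<^sup>1, Z]\<^sup>1\<^sup>,\<^sup>0\<close> becomes
  \<open>v \<mapsto> ([x, v] + J [J x, v])/2\<close>.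
\<close>

definition tangent_structure :: "('g::euclidean_space \<Rightarrow> 'g \<Rightarrow> 'g) \<Rightarrow> ('g \<Rightarrow> 'g) \<Rightarrow>
    ('r::finite \<Rightarrow> 'g form) \<Rightarrow> ('r \<Rightarrow> 'r \<Rightarrow> 'g form) \<Rightarrow> bool" where
  "tangent_structure br J \<eta> \<theta> \<longleftrightarrow> coframe J \<eta> \<and>
     (\<forall>a x v. \<eta> a [(1/2) *\<^sub>R (br x v + J (br (J x) v))] = (\<Sum>b\<in>UNIV. \<theta> a b [x] * \<eta> b [v]))"

text \<open>The matrix of \<open>D\<close> in the frame dual to \<open>\<eta>\<close>\<close>

definition represents_connection ::
  "('r::finite \<Rightarrow> 'g form) \<Rightarrow> ('g \<Rightarrow> 'g \<Rightarrow> 'g) \<Rightarrow> ('r \<Rightarrow> 'r \<Rightarrow> 'g form) \<Rightarrow> bool" where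
  "represents_connection \<eta> D \<sigma> \<longleftrightarrow>
     (\<forall>a b xs. length xs \<noteq> 1 \<longrightarrow> \<sigma> a b xs = 0) \<and>
     (\<forall>a x v. \<eta> a [D x v] = (\<Sum>b\<in>UNIV. \<sigma> a b [x] * \<eta> b [v]))"

text \<open>
  On an arbitrary Hermitian holomorphic bundle only the member \<open>\<kappa> = 1\<close> of the Gauduchon line is
  defined, namely the Chern connection; the whole line is defined if \<open>E = T\<^sup>1\<^sup>,\<^sup>0X\<close>.  In the latter
  case \<open>H\<close> is a Hermitian metric on \<open>X\<close>; the transposition relates \<open>\<langle>u, v\<rangle> = v\<^sup>* H u\<close> to the index
  convention of \<open>fund_form\<close>.
\<close>

definition bundle_gauduchon_connections :: "('g::euclidean_space \<Rightarrow> 'g \<Rightarrow> 'g) \<Rightarrow> ('g \<Rightarrow> 'g) \<Rightarrow>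
    real set \<Rightarrow> real \<Rightarrow> ('r::finite \<Rightarrow> 'r \<Rightarrow> 'g form) \<Rightarrow> (real \<Rightarrow> complex^'r^'r) \<Rightarrow>
    (real \<Rightarrow> 'r \<Rightarrow> 'r \<Rightarrow> 'g form) \<Rightarrow> bool" where
  "bundle_gauduchon_connections br J I \<kappa> \<theta> H \<sigma> \<longleftrightarrow>
     \<kappa> = 1 \<and> (\<forall>t\<in>I. bundle_chern_connection J \<theta> (H t) (\<sigma> t)) \<or>
     (\<exists>\<eta>. tangent_structure br J \<eta> \<theta> \<and>
       (\<forall>t\<in>I. \<exists>D. gauduchon_connection br J (metric_of J (fund_form \<eta> (transpose (H t)))) \<kappa> D \<and>
                   represents_connection \<eta> D (\<sigma> t)))"

definition bundle_curvature :: "('g \<Rightarrow> 'g \<Rightarrow> 'g) \<Rightarrow> ('r::finite \<Rightarrow> 'r \<Rightarrow> 'g form) \<Rightarrow>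
    'r \<Rightarrow> 'r \<Rightarrow> 'g form" where
  "bundle_curvature br \<sigma> a b xs = ext_d br (\<sigma> a b) xs + (\<Sum>c\<in>UNIV. (\<sigma> a c \<and>\<^sub>f \<sigma> c b) xs)"

text \<open>The curvature as an endomorphism of the fibre\<close>

definition curvature_endo :: "('r \<Rightarrow> 'r \<Rightarrow> 'g form) \<Rightarrow> 'g \<Rightarrow> 'g \<Rightarrow> complex^'r \<Rightarrow> complex^'r" where
  "curvature_endo A x y u = (\<chi> a b. A a b [x, y]) *v u"

section \<open>The flows\<close>

definition form_derivative :: "(real \<Rightarrow> 'g form) \<Rightarrow> 'g form \<Rightarrow> real \<Rightarrow> real set \<Rightarrow> bool" where
  "form_derivative \<phi> \<phi>' t I \<longleftrightarrow>
     (\<forall>xs. ((\<lambda>s. \<phi> s xs) has_vector_derivative \<phi>' xs) (at t within I))"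

definition i_ddbar :: "('g::euclidean_space \<Rightarrow> 'g \<Rightarrow> 'g) \<Rightarrow> ('g \<Rightarrow> 'g) \<Rightarrow> 'g form \<Rightarrow> 'g form" where
  "i_ddbar br J \<omega> xs = \<i> * del br J 1 2 (delbar br J 1 1 \<omega>) xs"

text \<open>\<open>Rm\<close> is the invariant form \<open>Tr(Rm\<^sup>\<tau> \<and> Rm\<^sup>\<tau>)\<close> of the metric \<open>\<omega>\<close>.\<close>

definition is_tangent_trace :: "('g::euclidean_space \<Rightarrow> 'g \<Rightarrow> 'g) \<Rightarrow> ('g \<Rightarrow> 'g) \<Rightarrow> 'g form \<Rightarrow>
    real \<Rightarrow> 'g form \<Rightarrow> bool" where
  "is_tangent_trace br J \<omega> \<tau> Rm \<longleftrightarrow>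
     (\<exists>D e. gauduchon_connection br J (metric_of J \<omega>) \<tau> D \<and>
            orthonormal_frame (metric_of J \<omega>) e \<and>
            Rm = trace_square (metric_of J \<omega>) e (curvature br D))"

definition is_bundle_trace :: "('g \<Rightarrow> 'g \<Rightarrow> 'g) \<Rightarrow> complex^'r^'r \<Rightarrow>
    ('r::finite \<Rightarrow> 'r \<Rightarrow> 'g form) \<Rightarrow> 'g form \<Rightarrow> bool" where
  "is_bundle_trace br H \<sigma> F \<longleftrightarrow>
     (\<exists>e. orthonormal_frame (bundle_metric H) e \<and>
          F = trace_square (bundle_metric H) e (curvature_endo (bundle_curvature br \<sigma>)))"

definition vol_12 :: "(3 \<Rightarrow> 'g form) \<Rightarrow> 'g form" where
  "vol_12 \<zeta> = \<zeta> 1 \<and>\<^sub>f \<zeta> 2 \<and>\<^sub>f conj_form (\<zeta> 1) \<and>\<^sub>f conj_form (\<zeta> 2)"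

definition flow_interval :: "real set \<Rightarrow> bool" where
  "flow_interval I \<longleftrightarrow> is_interval I \<and> 0 \<in> I"

text \<open>In both flows the metrics are \<open>\<omega>\<^sub>t = fund_form \<zeta> (h t)\<close>.  The factor \<open>c\<close> in the evolution of
  \<open>H\<close> accounts for the normalisation of the curvature: with the real curvature form \<open>A\<close> used
  here, the right-hand side is self-adjoint for imaginary \<open>c\<close> and skew-adjoint for \<open>c = 1\<close>.\<close>

definition flow_F1 :: "('g::euclidean_space \<Rightarrow> 'g \<Rightarrow> 'g) \<Rightarrow> ('g \<Rightarrow> 'g) \<Rightarrow> (3 \<Rightarrow> 'g form) \<Rightarrow>
    real \<Rightarrow> real \<Rightarrow> real \<Rightarrow> complex \<Rightarrow> real set \<Rightarrow> (real \<Rightarrow> complex^3^3) \<Rightarrow>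
    ('r::finite \<Rightarrow> 'r \<Rightarrow> 'g form) \<Rightarrow> (real \<Rightarrow> complex^'r^'r) \<Rightarrow>
    (real \<Rightarrow> 'r \<Rightarrow> 'r \<Rightarrow> 'g form) \<Rightarrow> bool" where
  "flow_F1 br J \<zeta> \<alpha>' \<tau> \<kappa> c I h \<theta> H \<sigma> \<longleftrightarrow>
     holomorphic_structure br J \<theta> \<and>
     bundle_gauduchon_connections br J I \<kappa> \<theta> H \<sigma> \<and>
     (\<forall>t\<in>I. pos_def_hermitian (h t) \<and> pos_def_hermitian (H t) \<and>
       (\<exists>Rm F. is_tangent_trace br J (fund_form \<zeta> (h t)) \<tau> Rm \<and>
         is_bundle_trace br (H t) (\<sigma> t) F \<and>
         (\<exists>m. F = (\<lambda>xs. m * vol_12 \<zeta> xs)) \<and>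
         form_derivative
           (\<lambda>s xs. norm_Psi (h s) * (fund_form \<zeta> (h s) \<and>\<^sub>f fund_form \<zeta> (h s)) xs)
           (\<lambda>xs. i_ddbar br J (fund_form \<zeta> (h t)) xs - \<alpha>' / 4 * (Rm xs - F xs)) t I) \<and>
       (\<exists>H'. (H has_vector_derivative H') (at t within I) \<and>
         (\<forall>a b xs. let \<omega> = fund_form \<zeta> (h t) in
           (matrix_inv (H t) ** H') $ a $ b * (\<omega> \<and>\<^sub>f \<omega> \<and>\<^sub>f \<omega>) xs =
           c * (\<omega> \<and>\<^sub>f \<omega> \<and>\<^sub>f bundle_curvature br (\<sigma> t) a b) xs)))"

definition flow_F2 :: "('g::euclidean_space \<Rightarrow> 'g \<Rightarrow> 'g) \<Rightarrow> ('g \<Rightarrow> 'g) \<Rightarrow> (3 \<Rightarrow> 'g form) \<Rightarrow>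
    real \<Rightarrow> real \<Rightarrow> real set \<Rightarrow> (real \<Rightarrow> complex^3^3) \<Rightarrow> bool" where
  "flow_F2 br J \<zeta> \<alpha>' \<tau> I h \<longleftrightarrow>
     (\<forall>t\<in>I. pos_def_hermitian (h t) \<and>
       (\<exists>Rm. is_tangent_trace br J (fund_form \<zeta> (h t)) \<tau> Rm \<and>
         form_derivative
           (\<lambda>s xs. norm_Psi (h s) * (fund_form \<zeta> (h s) \<and>\<^sub>f fund_form \<zeta> (h s)) xs)
           (\<lambda>xs. i_ddbar br J (fund_form \<zeta> (h t)) xs - \<alpha>' / 4 * Rm xs) t I))"

end

theory Submission
  imports Defs
begin

text \<open>
  The exterior derivative of \<open>\<parallel>\<Psi>\<parallel> \<omega>\<^sup>2\<close> is constant along both flows, because the right-hand sides are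
  closed: \<open>Tr(Rm \<and> Rm)\<close> is closed by the second Bianchi identity and the invariance of the trace form
  under commutators (Chern--Weil), and \<open>i\<partial>\<partial>bar \<omega>\<close> is a multiple of the closed form
  \<open>\<zeta>\<^sup>1 \<and> \<zeta>\<^sup>2 \<and> conj \<zeta>\<^sup>1 \<and> conj \<zeta>\<^sup>2\<close>.  Since \<open>\<parallel>\<Psi>\<parallel>\<close> is a nonzero scalar, \<open>\<omega>\<^sub>t\<close> stays balanced.
\<close>

text \<open>Only the closedness of \<open>Tr(Rm \<and> Rm)\<close> is used, never its value.
  Closedness holds for every metric connection on the Lie algebra, with torsion or without, so all
  values of \<tau> are covered at once and no Gauduchon connection has to be computed. The bundle
  term is closed because it is assumed to be a multiple of \<open>vol_12 \<zeta>\<close>. For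
  \<open>i_ddbar\<close> an explicit route is taken: \<open>del\<close> and \<open>delbar\<close>
  are definite descriptions, so they can be evaluated only by exhibiting the two type components of
  a derivative, and these are read off the structure equations. The obstacle throughout is that a
  form is a bare function on argument lists. Alternation, multilinearity and the Leibniz rule are
  not built in. Identities between forms are therefore checked on lists of symbolic vectors:
  homogeneity fixes the one relevant length, the contraction rule for the wedge expands every
  product, and what remains is a polynomial identity in the values of the factors.\<close>

section \<open>Wedge products and exterior derivatives on explicit argument lists\<close>

lemma wedge_Nil: "(\<alpha> \<and>\<^sub>f \<beta>) [] = \<alpha> [] * \<beta> []"
  by (simp add: wedge_def)

text \<open>If position 0 goes to the second factor, each of the \<open>card B\<close> arguments of
  the first factor is moved past it once. These are the extra inversions (i + 1, 0).\<close>

lemma card_inversions_Suc_image: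
  fixes B :: "nat set"
  assumes "finite B"
  shows "card {(i, j). i \<in> Suc ` B \<and> j < i \<and> j \<notin> Suc ` B}
       = card {(i, j). i \<in> B \<and> j < i \<and> j \<notin> B} + card B"
proof -
  have fin: "finite {(i, j). i \<in> B \<and> j < i \<and> j \<notin> B}"
    by (rule finite_subset[of _ "Sigma B (\<lambda>i. {..<i})"]) (use assms in auto)
  have "{(i, j). i \<in> Suc ` B \<and> j < i \<and> j \<notin> Suc ` B}
      = map_prod Suc Suc ` {(i, j). i \<in> B \<and> j < i \<and> j \<notin> B} \<union> (\<lambda>i. (Suc i, 0)) ` B" (is "?L = ?R")
  proof (rule subset_antisym; rule subsetI)
    fix p assume "p \<in> ?L"
    then obtain i j where p: "p = (Suc i, j)" "i \<in> B" "j < Suc i" "j \<notin> Suc ` B" by auto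
    then show "p \<in> ?R" by (cases j) (auto simp: image_iff)
  qed auto
  also have "card \<dots> = card (map_prod Suc Suc ` {(i, j). i \<in> B \<and> j < i \<and> j \<notin> B})
      + card ((\<lambda>i. (Suc i, 0::nat)) ` B)"
    using fin assms by (intro card_Un_disjoint) auto
  also have "\<dots> = card {(i, j). i \<in> B \<and> j < i \<and> j \<notin> B} + card B"
    by (subst (1 2) card_image) (auto simp: inj_on_def map_prod_def)
  finally show ?thesis .
qed

text \<open>Position 0 in the first factor takes part in no inversion: nothing lies to its left, and
  as an element of the set it cannot be the second entry of a pair.\<close>

lemma card_inversions_insert_0:
  fixes B :: "nat set"
  shows "card {(i, j). i \<in> insert 0 (Suc ` B) \<and> j < i \<and> j \<notin> insert 0 (Suc ` B)}
       = card {(i, j). i \<in> B \<and> j < i \<and> j \<notin> B}"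
proof -
  have "{(i, j). i \<in> insert 0 (Suc ` B) \<and> j < i \<and> j \<notin> insert 0 (Suc ` B)}
      = map_prod Suc Suc ` {(i, j). i \<in> B \<and> j < i \<and> j \<notin> B}" (is "?L = ?R")
  proof (rule subset_antisym; rule subsetI)
    fix p assume "p \<in> ?L"
    then obtain i j where p: "p = (Suc i, j)" "i \<in> B" "j < Suc i" "j \<notin> Suc ` B" "j \<noteq> 0" by auto
    then show "p \<in> ?R" by (cases j) (auto simp: image_iff)
  qed auto
  then show ?thesis by (simp add: card_image inj_on_def map_prod_def)
qed

text \<open>Contraction with \<open>x\<close> is an antiderivation of the exterior algebra.\<close>

lemma wedge_Cons:
  "(\<alpha> \<and>\<^sub>f \<beta>) (x # xs) = ((\<lambda>ys. \<alpha> (x # ys)) \<and>\<^sub>f \<beta>) xs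
     + ((\<lambda>ys. (-1) ^ length ys * \<alpha> ys) \<and>\<^sub>f (\<lambda>ys. \<beta> (x # ys))) xs"
proof -
  let ?n = "length xs"
  let ?inv = "\<lambda>A :: nat set. card {(i, j). i \<in> A \<and> j < i \<and> j \<notin> A}"
  let ?f = "\<lambda>A. (-1) ^ ?inv A * \<alpha> (nths (x # xs) A) * \<beta> (nths (x # xs) (- A))"
  \<comment> \<open>The shuffles are split according to whether position 0, that is the argument
    \<open>x\<close>, goes to \<alpha> or to \<beta>.\<close>
  have Pow: "Pow {..<length (x # xs)}
      = (\<lambda>B. insert 0 (Suc ` B)) ` Pow {..<?n} \<union> (`) Suc ` Pow {..<?n}"
    unfolding length_Cons lessThan_Suc_eq_insert_0 Pow_insert image_Pow_surj[OF refl, symmetric]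
    by (simp add: image_image Un_commute)
  have "(\<alpha> \<and>\<^sub>f \<beta>) (x # xs) = (\<Sum>A\<in>(\<lambda>B. insert 0 (Suc ` B)) ` Pow {..<?n}. ?f A)
      + (\<Sum>A\<in>(`) Suc ` Pow {..<?n}. ?f A)"
    unfolding wedge_def Pow by (rule sum.union_disjoint) auto
  also have "(\<Sum>A\<in>(\<lambda>B. insert 0 (Suc ` B)) ` Pow {..<?n}. ?f A)
      = (\<Sum>B\<in>Pow {..<?n}. ?f (insert 0 (Suc ` B)))"
  proof (subst sum.reindex, goal_cases)
    case 1
    show ?case
    proof (rule inj_onI)
      fix B C :: "nat set" assume "insert 0 (Suc ` B) = insert 0 (Suc ` C)"
      then have "Suc ` B = Suc ` C" by (subst (asm) insert_ident) auto
      then show "B = C" by (simp add: inj_image_eq_iff)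
    qed
  qed simp
  also have "\<dots> = ((\<lambda>ys. \<alpha> (x # ys)) \<and>\<^sub>f \<beta>) xs"
    unfolding wedge_def
  proof (intro sum.cong refl)
    fix B assume "B \<in> Pow {..<?n}"
    have "{j. Suc j \<in> insert 0 (Suc ` B)} = B" "{j. Suc j \<notin> insert 0 (Suc ` B)} = - B"
      by auto
    then show "?f (insert 0 (Suc ` B)) = (-1) ^ ?inv B * \<alpha> (x # nths xs B) * \<beta> (nths xs (- B))"
      unfolding card_inversions_insert_0 by (simp add: nths_Cons)
  qed
  also have "(\<Sum>A\<in>(`) Suc ` Pow {..<?n}. ?f A) = (\<Sum>B\<in>Pow {..<?n}. ?f (Suc ` B))"
    by (subst sum.reindex) (auto simp: inj_on_def inj_image_eq_iff)
  also have "\<dots> = ((\<lambda>ys. (-1) ^ length ys * \<alpha> ys) \<and>\<^sub>f (\<lambda>ys. \<beta> (x # ys))) xs"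
    unfolding wedge_def
  proof (intro sum.cong refl)
    fix B assume B: "B \<in> Pow {..<?n}"
    then have fin: "finite B" using finite_subset by auto
    have "{j. Suc j \<in> Suc ` B} = B" "{j. Suc j \<notin> Suc ` B} = - B" by auto
    moreover have "length (nths xs B) = card B"
      unfolding length_nths by (rule arg_cong[of _ _ card]) (use B in auto)
    ultimately show "?f (Suc ` B) = (-1) ^ ?inv B * ((-1) ^ length (nths xs B) * \<alpha> (nths xs B))
        * \<beta> (x # nths xs (- B))"
      unfolding card_inversions_Suc_image[OF fin] by (simp add: nths_Cons power_add)
  qed
  finally show ?thesis .
qed

text \<open>Forms are total functions on lists. Knowing the degree removes the terms of wrong length
  that \<open>wedge_Cons\<close> produces, and reduces an equality of forms to lists of a single
  length.\<close>

definition homogeneous :: "nat \<Rightarrow> 'g form \<Rightarrow> bool" where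
  "homogeneous p \<alpha> \<longleftrightarrow> (\<forall>xs. length xs \<noteq> p \<longrightarrow> \<alpha> xs = 0)"

lemma homogeneousD: "homogeneous p \<alpha> \<Longrightarrow> length xs \<noteq> p \<Longrightarrow> \<alpha> xs = 0"
  by (simp add: homogeneous_def)

lemma length_nths_compl: "length (nths xs A) + length (nths xs (- A)) = length xs"
proof -
  have "{..<length xs} = {i. i < length xs \<and> i \<in> A} \<union> {i. i < length xs \<and> i \<in> - A}"
    by auto
  then have "card {..<length xs} = card {i. i < length xs \<and> i \<in> A} + card {i. i < length xs \<and> i \<in> - A}"
    by (simp only:) (rule card_Un_disjoint, auto)
  then show ?thesis by (simp add: length_nths)
qed

lemma homogeneous_wedge:
  assumes "homogeneous p \<alpha>" "homogeneous q \<beta>"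
  shows "homogeneous (p + q) (\<alpha> \<and>\<^sub>f \<beta>)"
  unfolding homogeneous_def wedge_def
proof (intro allI impI sum.neutral ballI)
  fix xs :: "'a list" and A
  assume "length xs \<noteq> p + q"
  then have "length (nths xs A) \<noteq> p \<or> length (nths xs (- A)) \<noteq> q"
    using length_nths_compl[of xs A] by auto
  then show "(- 1) ^ card {(i, j). i \<in> A \<and> j < i \<and> j \<notin> A} * \<alpha> (nths xs A) * \<beta> (nths xs (- A)) = 0"
    using assms by (auto simp: homogeneous_def)
qed

lemma homogeneous_ext_d:
  assumes "homogeneous p \<alpha>" 
  shows "homogeneous (Suc p) (ext_d br \<alpha>)"
  unfolding homogeneous_def ext_d_def
proof (intro allI impI sum.neutral ballI)
  fix xs :: "'a list" and z
  assume l: "length xs \<noteq> Suc p" and z: "z \<in> {(i, j). i < j \<and> j < length xs}"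
  obtain i j where ij: "z = (i, j)" "i < j" "j < length xs" using z by auto
  have "length (nths xs {i, j}) = card {i, j}"
    unfolding length_nths by (rule arg_cong[of _ _ card]) (use ij in auto)
  then have "length (nths xs (- {i, j})) + 2 = length xs"
    using length_nths_compl[of xs "{i, j}"] ij by simp
  then show "(case z of (i, j) \<Rightarrow> (- 1) ^ (i + j) * \<alpha> (br (xs ! i) (xs ! j) # nths xs (- {i, j}))) = 0"
    using assms l ij by (auto simp: homogeneous_def)
qed

lemma wedge_one_form:
  assumes "homogeneous 1 f"
  shows "(f \<and>\<^sub>f \<alpha>) [x] = f [x] * \<alpha> []"
    and "(f \<and>\<^sub>f \<alpha>) [x, y] = f [x] * \<alpha> [y] - f [y] * \<alpha> [x]"
    and "(f \<and>\<^sub>f \<alpha>) [x, y, z] = f [x] * \<alpha> [y, z] - f [y] * \<alpha> [x, z] + f [z] * \<alpha> [x, y]"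
    and "(f \<and>\<^sub>f \<alpha>) [x, y, z, w] = f [x] * \<alpha> [y, z, w] - f [y] * \<alpha> [x, z, w]
           + f [z] * \<alpha> [x, y, w] - f [w] * \<alpha> [x, y, z]"
  using homogeneousD[OF assms] by (simp_all add: wedge_Cons wedge_Nil)

lemma wedge_two_forms:
  assumes "homogeneous 2 \<alpha>" "homogeneous 2 \<beta>"
  shows "(\<alpha> \<and>\<^sub>f \<beta>) [x, y, z, w] = \<alpha> [x, y] * \<beta> [z, w] - \<alpha> [x, z] * \<beta> [y, w]
           + \<alpha> [x, w] * \<beta> [y, z] + \<alpha> [y, z] * \<beta> [x, w] - \<alpha> [y, w] * \<beta> [x, z] + \<alpha> [z, w] * \<beta> [x, y]"
  using homogeneousD[OF assms(1)] homogeneousD[OF assms(2)] by (simp add: wedge_Cons wedge_Nil)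

text \<open>The set of index pairs is replaced by nested initial segments, which the simplifier can
  unfold on a concrete list.\<close>

lemma ext_d_eq_double_sum:
  "ext_d br \<alpha> xs = (\<Sum>j<length xs. \<Sum>i<j.
     (-1) ^ (i + j) * \<alpha> (br (xs ! i) (xs ! j) # nths xs (- {i, j})))"
  unfolding ext_d_def sum.Sigma[OF finite_lessThan ballI[OF finite_lessThan]]
  by (rule sum.reindex_bij_witness[of _ prod.swap prod.swap]) auto

lemma ext_d_lists:
  shows "ext_d br \<alpha> [x, y] = - \<alpha> [br x y]"
    and "ext_d br \<alpha> [x, y, z] = - \<alpha> [br x y, z] + \<alpha> [br x z, y] - \<alpha> [br y z, x]"
    and "ext_d br \<alpha> [x, y, z, w] = - \<alpha> [br x y, z, w] + \<alpha> [br x z, y, w] - \<alpha> [br x w, y, z]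
      - \<alpha> [br y z, x, w] + \<alpha> [br y w, x, z] - \<alpha> [br z w, x, y]"
    and "ext_d br \<alpha> [x, y, z, w, v] = - \<alpha> [br x y, z, w, v] + \<alpha> [br x z, y, w, v]
      - \<alpha> [br x w, y, z, v] + \<alpha> [br x v, y, z, w] - \<alpha> [br y z, x, w, v] + \<alpha> [br y w, x, z, v]
      - \<alpha> [br y v, x, z, w] - \<alpha> [br z w, x, y, v] + \<alpha> [br z v, x, y, w] - \<alpha> [br w v, x, y, z]"
  by (simp_all add: ext_d_eq_double_sum nths_Cons)

section \<open>The invariant trace form on endomorphisms\<close>

lemma sum_lessThan_triangle:
  fixes f :: "nat \<Rightarrow> nat \<Rightarrow> real"
  assumes "\<And>i j. f i j = f j i" "\<And>i. f i i = 0"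
  shows "2 * (\<Sum>j<n. \<Sum>i<j. f i j) = (\<Sum>j<n. \<Sum>i<n. f i j)"
proof (induction n)
  case (Suc n)
  have "(\<Sum>i<n. f n i) = (\<Sum>i<n. f i n)"
    by (simp add: assms(1)[of n])
  then show ?case using Suc by (simp add: sum.distrib assms(2) algebra_simps)
qed simp

locale symmetric_form_frame =
  fixes g :: "'v::euclidean_space \<Rightarrow> 'v \<Rightarrow> real" and e :: "nat \<Rightarrow> 'v"
  assumes bil: "bilinear g" and sym: "\<And>x y. g x y = g y x"
    and frame: "orthonormal_frame g e"
begin

lemma linear_left: "linear (\<lambda>x. g x y)" and linear_right: "linear (g x)"
  using bil by (simp_all add: bilinear_def)

text \<open>Pairing with \<open>e j\<close> recovers the j-th coefficient of a combination of the
  frame, so the frame is linearly independent; having \<open>DIM('v)\<close> members, it spans.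
  Nondegeneracy of \<open>g\<close> is thus a consequence of the frame.\<close>

lemma expansion: "v = (\<Sum>i<DIM('v). g v (e i) *\<^sub>R e i)"
proof -
  let ?n = "DIM('v)"
  have on: "g (e i) (e j) = (if i = j then 1 else 0)" if "i < ?n" "j < ?n" for i j
    using frame that by (simp add: orthonormal_frame_def)
  have coeff: "g (\<Sum>i<?n. c i *\<^sub>R e i) (e j) = c j" if "j < ?n" for c j
  proof -
    have "g (\<Sum>i<?n. c i *\<^sub>R e i) (e j) = (\<Sum>i<?n. c i * g (e i) (e j))"
      by (simp add: linear_sum[OF linear_left] linear_cmul[OF linear_left])
    also have "\<dots> = (\<Sum>i<?n. if i = j then c i else 0)"
      using on that by (intro sum.cong) auto
    finally show ?thesis using that by simp
  qed
  have inj: "inj_on e {..<?n}"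
    by (rule inj_onI) (metis lessThan_iff on zero_neq_one)
  have "independent (e ` {..<?n})"
  proof (rule independent_if_scalars_zero)
    fix c v assume *: "(\<Sum>x\<in>e ` {..<?n}. c x *\<^sub>R x) = 0" and "v \<in> e ` {..<?n}"
    then obtain j where j: "j < ?n" "v = e j" by auto
    have "(\<Sum>i<?n. c (e i) *\<^sub>R e i) = 0" using * by (simp add: sum.reindex[OF inj])
    then show "c v = 0" using coeff[OF j(1), of "\<lambda>i. c (e i)"] j(2)
      by (simp add: linear_0[OF linear_left])
  qed auto
  then have "span (e ` {..<?n}) = UNIV"
    by (metis card_image[OF inj] card_lessThan card_eq_dim dim_UNIV finite_imageI finite_lessThan
        subset_UNIV top.extremum_uniqueI)
  then obtain c where "v = (\<Sum>x\<in>e ` {..<?n}. c x *\<^sub>R x)"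
    using span_finite[of "e ` {..<?n}"] by auto
  then have "v = (\<Sum>i<?n. c (e i) *\<^sub>R e i)" by (simp add: sum.reindex[OF inj])
  then show ?thesis using coeff[of _ "\<lambda>i. c (e i)"] by (metis (no_types, lifting) lessThan_iff sum.cong)
qed

lemma parseval: "g u v = (\<Sum>i<DIM('v). g u (e i) * g v (e i))"
proof -
  have "g u v = g u (\<Sum>i<DIM('v). g v (e i) *\<^sub>R e i)" using expansion[of v] by simp
  also have "\<dots> = (\<Sum>i<DIM('v). g v (e i) * g u (e i))"
    by (simp add: linear_sum[OF linear_right] linear_cmul[OF linear_right])
  finally show ?thesis by (simp add: mult.commute)
qed

text \<open>This is tr(A* B), with A* the adjoint for \<open>g\<close>; for skew-adjoint A it equals
  -tr(A B), the form that appears in Chern-Weil theory.\<close>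

definition endo_inner :: "('v \<Rightarrow> 'v) \<Rightarrow> ('v \<Rightarrow> 'v) \<Rightarrow> real" where
  "endo_inner A B = (\<Sum>j<DIM('v). g (A (e j)) (B (e j)))"

lemma endo_inner_commute: "endo_inner A B = endo_inner B A"
  by (simp add: endo_inner_def sym)

text \<open>Infinitesimal form of the invariance of tr(A* B) under orthogonal conjugation. The terms
  with X on the outside cancel when X is moved across \<open>g\<close>. In the terms with X on the
  inside, X e_j is expanded in the frame, and they cancel because the matrix of X is
  antisymmetric.\<close>

lemma endo_inner_commutator:
  assumes X: "\<And>u v. g (X u) v = - g u (X v)" and A: "linear A" and B: "linear B"
  shows "endo_inner (\<lambda>v. X (A v) - A (X v)) B = - endo_inner A (\<lambda>v. X (B v) - B (X v))"
proof -
  let ?n = "DIM('v)"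
  have *: "(\<Sum>j<?n. g (A (X (e j))) (B (e j))) = (\<Sum>j<?n. \<Sum>k<?n. g (X (e j)) (e k) * g (A (e k)) (B (e j)))"
    if "linear A" for A B
  proof (intro sum.cong refl)
    fix j
    have "A (X (e j)) = (\<Sum>k<?n. g (X (e j)) (e k) *\<^sub>R A (e k))"
      by (subst expansion[of "X (e j)"]) (simp add: linear_sum[OF that] linear_cmul[OF that])
    then show "g (A (X (e j))) (B (e j)) = (\<Sum>k<?n. g (X (e j)) (e k) * g (A (e k)) (B (e j)))"
      by (simp add: linear_sum[OF linear_left] linear_cmul[OF linear_left])
  qed
  have "(\<Sum>j<?n. g (A (e j)) (B (X (e j)))) = (\<Sum>j<?n. g (B (X (e j))) (A (e j)))"
    by (simp add: sym)
  also have "\<dots> = (\<Sum>j<?n. \<Sum>k<?n. g (X (e j)) (e k) * g (B (e k)) (A (e j)))"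
    by (rule *[OF B])
  also have "\<dots> = (\<Sum>k<?n. \<Sum>j<?n. g (X (e j)) (e k) * g (B (e k)) (A (e j)))"
    by (rule sum.swap)
  also have "\<dots> = (\<Sum>k<?n. \<Sum>j<?n. - (g (X (e k)) (e j) * g (A (e j)) (B (e k))))"
    using X sym by (intro sum.cong refl) (metis mult_minus_left)
  also have "\<dots> = - (\<Sum>j<?n. g (A (X (e j))) (B (e j)))"
    unfolding *[OF A] by (simp add: sum_negf)
  finally have "(\<Sum>j<?n. g (A (e j)) (B (X (e j)))) + (\<Sum>j<?n. g (A (X (e j))) (B (e j))) = 0"
    by simp
  then show ?thesis
    unfolding endo_inner_def linear_diff[OF linear_left] linear_diff[OF linear_right] X
    by (simp add: sum_subtractf sum_negf)
qed

text \<open>The six shuffles in \<Omega> \<and> \<Omega> coincide in pairs, which gives a factor 2.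
  For skew endomorphisms the products of matrix entries are symmetric in i, j and vanish on the
  diagonal, so twice the sum over i < j is the full sum, which \<open>parseval\<close> turns into
  \<open>endo_inner\<close>.\<close>

lemma trace_square_eq:
  assumes skew: "\<And>x y u v. g (R x y u) v = - g u (R x y v)"
  shows "trace_square g e R [x, y, z, w] = complex_of_real
     (endo_inner (R x y) (R z w) - endo_inner (R x z) (R y w) + endo_inner (R x w) (R y z))"
proof -
  let ?n = "DIM('v)"
  have tri: "(\<Sum>j<?n. \<Sum>i<j. 2 * (g (P (e j)) (e i) * g (Q (e j)) (e i))) = endo_inner P Q"
    if "\<And>u v. g (P u) v = - g u (P v)" "\<And>u v. g (Q u) v = - g u (Q v)" for P Q
  proof -
    have P: "g (P u) v = - g (P v) u" and Q: "g (Q u) v = - g (Q v) u" for u v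
      using that sym by metis+
    have "2 * (\<Sum>j<?n. \<Sum>i<j. g (P (e j)) (e i) * g (Q (e j)) (e i))
        = (\<Sum>j<?n. \<Sum>i<?n. g (P (e j)) (e i) * g (Q (e j)) (e i))"
    proof (rule sum_lessThan_triangle)
      show "g (P (e j)) (e i) * g (Q (e j)) (e i) = g (P (e i)) (e j) * g (Q (e i)) (e j)" for i j
        using P[of "e j" "e i"] Q[of "e j" "e i"] by simp
      show "g (P (e i)) (e i) * g (Q (e i)) (e i) = 0" for i
        using P[of "e i" "e i"] by simp
    qed
    then show ?thesis by (simp add: endo_inner_def parseval[symmetric] sum_distrib_left)
  qed
  have hom: "homogeneous 2 (form2 f)" for f :: "'b \<Rightarrow> 'b \<Rightarrow> complex"
    by (simp add: homogeneous_def form2_def)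
  have "trace_square g e R [x, y, z, w] = complex_of_real (\<Sum>j<?n. \<Sum>i<j.
      2 * (g (R x y (e j)) (e i) * g (R z w (e j)) (e i))
      - 2 * (g (R x z (e j)) (e i) * g (R y w (e j)) (e i))
      + 2 * (g (R x w (e j)) (e i) * g (R y z (e j)) (e i)))"
    unfolding trace_square_def Let_def wedge_two_forms[OF hom hom] of_real_sum
    by (intro sum.cong refl) (simp add: form2_def)
  also have "\<dots> = complex_of_real
     (endo_inner (R x y) (R z w) - endo_inner (R x z) (R y w) + endo_inner (R x w) (R y z))"
    unfolding sum.distrib sum_subtractf tri[OF skew skew] by simp
  finally show ?thesis .
qed

end

section \<open>Second Bianchi identity and closedness of the trace of the squared curvature\<close>

lemma ext_d_eq_0I:
  assumes "homogeneous p \<alpha>" "\<And>xs. length xs = Suc p \<Longrightarrow> ext_d br \<alpha> xs = 0"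
  shows "ext_d br \<alpha> = (\<lambda>_. 0)"
  using homogeneousD[OF homogeneous_ext_d[OF assms(1)]] assms(2) by fastforce

lemma homogeneous_form2: "homogeneous 2 (form2 f)"
  by (simp add: homogeneous_def form2_def)

lemma homogeneous_trace_square: "homogeneous 4 (trace_square g e R)"
  by (simp add: homogeneous_def trace_square_def
      homogeneousD[OF homogeneous_wedge[OF homogeneous_form2 homogeneous_form2]])

lemma lie_bracket_skew:
  assumes "lie_bracket br"
  shows "br y x = - br x y"
proof -
  have b: "bilinear br" and 0: "br x x = 0" "br y y = 0" "br (x + y) (x + y) = 0"
    using assms by (simp_all add: lie_bracket_def)
  have "br (x + y) (x + y) = br x x + br x y + (br y x + br y y)"
    by (simp add: bilinear_ladd[OF b] bilinear_radd[OF b])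
  then show ?thesis using 0 by (simp add: eq_neg_iff_add_eq_0 add.commute)
qed

text \<open>After expansion the triple products of D cancel as in the Jacobi identity for operators,
  the products of D with D along a bracket agree on both sides, and the terms along iterated
  brackets cancel by the Jacobi identity of \<open>br\<close>. Torsion does not enter, because D
  differentiates only the fibre vector \<open>v\<close>.\<close>

lemma second_bianchi:
  assumes br: "lie_bracket br" and D: "bilinear D"
  defines "R \<equiv> curvature br D"
  shows "R (br x y) z v - R (br x z) y v + R (br y z) x v
       = (D x (R y z v) - R y z (D x v)) - (D y (R x z v) - R x z (D y v)) + (D z (R x y v) - R x y (D z v))"
proof -
  note b = lie_bracket_skew[OF br]
  have bb: "bilinear br" using br by (simp add: lie_bracket_def)
  have "br x (br y z) + br y (br z x) + br z (br x y) = 0" using br by (simp add: lie_bracket_def)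
  moreover have "br x (br y z) = - br (br y z) x" "br z (br x y) = - br (br x y) z"
    by (rule b)+
  moreover have "br y (br z x) = br (br x z) y"
    using b[of "br z x" y] b[of x z] by (simp add: bilinear_lneg[OF bb])
  ultimately have J: "br (br x y) z = br (br x z) y - br (br y z) x"
    by (simp add: algebra_simps)
  show ?thesis
    unfolding R_def curvature_def J
    by (simp add: bilinear_lsub[OF D] bilinear_rsub[OF D] bilinear_radd[OF D] algebra_simps)
qed

text \<open>On five vectors there are ten brackets, and each contributes three pairings of
  curvatures. The 30 terms regroup into ten Bianchi triples, one for each pair {p, q} left outside
  the triple. Bianchi replaces them by 30 terms with a commutator, which cancel in pairs by
  invariance of the trace form.\<close>

lemma ext_d_trace_square_curvature:
  assumes br: "lie_bracket br" and g: "bilinear g" "\<And>x y. g x y = g y x"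
    and D: "bilinear D" and metric: "\<And>x y z. g (D x y) z + g y (D x z) = 0"
    and e: "orthonormal_frame g e"
  shows "ext_d br (trace_square g e (curvature br D)) = (\<lambda>_. 0)"
proof (rule ext_d_eq_0I[OF homogeneous_trace_square])
  fix xs :: "'a list"
  assume "length xs = Suc 4"
  then obtain x y z w v where xs: "xs = [x, y, z, w, v]"
    by (auto simp: numeral_eq_Suc length_Suc_conv)
  interpret symmetric_form_frame g e by standard (use g e in auto)
  define R where "R = curvature br D"
  have X: "g (D x u) v = - g u (D x v)" for x u v
    using metric[of x u v] by simp
  have skew: "g (R x y u) v = - g u (R x y v)" for x y u v
    by (simp add: R_def curvature_def linear_diff[OF linear_left] linear_diff[OF linear_right] X)
  have lin: "linear (R x y)" for x y
    unfolding R_def curvature_def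
    by (rule linearI) (simp_all add: bilinear_radd[OF D] bilinear_rmul[OF D] algebra_simps)
  \<comment> \<open>\<open>t\<close> collects the terms produced by the exterior derivative, with a
    bracket inside one curvature; \<open>s\<close> collects the terms with a commutator
    [D_a, R(b, c)] in its place.\<close>
  define t where "t a b c p q = endo_inner (R (br a b) c) (R p q)" for a b c p q
  define s where "s a b c p q = endo_inner (\<lambda>v. D a (R b c v) - R b c (D a v)) (R p q)" for a b c p q
  have bianchi: "t a b c p q - t a c b p q + t b c a p q = s a b c p q - s b a c p q + s c a b p q"
    for a b c p q
    unfolding t_def s_def endo_inner_def sum.distrib[symmetric] sum_subtractf[symmetric]
    by (intro sum.cong refl)
      (simp only: linear_diff[OF linear_left, symmetric] linear_add[OF linear_left, symmetric]
        second_bianchi[OF br D, folded R_def])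
  \<comment> \<open>Invariance moves the commutator with D_a onto R(p, q); it applies because D_a is
    skew for the metric.\<close>
  have ad: "s a b c p q = - s a p q b c" for a b c p q
    unfolding s_def by (subst endo_inner_commutator[OF X lin lin]) (simp add: endo_inner_commute)
  have "trace_square g e R [br a b, c, p, q] = complex_of_real (t a b c p q - t a b p c q + t a b q c p)"
    for a b c p q
    unfolding t_def by (rule trace_square_eq[OF skew])
  moreover have "(t x y z w v - t x y w z v + t x y v z w) * (-1) + (t x z y w v - t x z w y v + t x z v y w)
      - (t x w y z v - t x w z y v + t x w v y z) + (t x v y z w - t x v z y w + t x v w y z)
      - (t y z x w v - t y z w x v + t y z v x w) + (t y w x z v - t y w z x v + t y w v x z)
      - (t y v x z w - t y v z x w + t y v w x z) - (t z w x y v - t z w y x v + t z w v x y)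
      + (t z v x y w - t z v y x w + t z v w x y) - (t w v x y z - t w v y x z + t w v z x y) = 0"
  proof -
    have "(t x y z w v - t x y w z v + t x y v z w) * (-1) + (t x z y w v - t x z w y v + t x z v y w)
      - (t x w y z v - t x w z y v + t x w v y z) + (t x v y z w - t x v z y w + t x v w y z)
      - (t y z x w v - t y z w x v + t y z v x w) + (t y w x z v - t y w z x v + t y w v x z)
      - (t y v x z w - t y v z x w + t y v w x z) - (t z w x y v - t z w y x v + t z w v x y)
      + (t z v x y w - t z v y x w + t z v w x y) - (t w v x y z - t w v y x z + t w v z x y)
      = 0 - (t x y z w v - t x z y w v + t y z x w v) + (t x y w z v - t x w y z v + t y w x z v) - (t x y v z w - t x v y z w + t y v x z w) - (t x z w y v - t x w z y v + t z w x y v) + (t x z v y w - t x v z y w + t z v x y w) - (t x w v y z - t x v w y z + t w v x y z) + (t y z w x v - t y w z x v + t z w y x v) - (t y z v x w - t y v z x w + t z v y x w) + (t y w v x z - t y v w x z + t w v y x z) - (t z w v x y - t z v w x y + t w v z x y)"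
      by (simp add: algebra_simps)
    also have "\<dots> = 0 - (s x y z w v - s y x z w v + s z x y w v) + (s x y w z v - s y x w z v + s w x y z v) - (s x y v z w - s y x v z w + s v x y z w) - (s x z w y v - s z x w y v + s w x z y v) + (s x z v y w - s z x v y w + s v x z y w) - (s x w v y z - s w x v y z + s v x w y z) + (s y z w x v - s z y w x v + s w y z x v) - (s y z v x w - s z y v x w + s v y z x w) + (s y w v x z - s w y v x z + s v y w x z) - (s z w v x y - s w z v x y + s v z w x y)"
      unfolding bianchi ..
    \<comment> \<open>Exchanging (b, c) with (p, q) is an even permutation, so the two terms related
      by \<open>ad\<close> carry the same sign in the sum and cancel. There are 15 such pairs: five
      choices of a, and three splittings of the other four vectors.\<close>
    also have "\<dots> = 0"
      unfolding ad[of x y z w v] ad[of x y w z v] ad[of x y v z w] ad[of y x z w v] ad[of y x w z v] ad[of y x v z w] ad[of z x y w v] ad[of z x w y v] ad[of z x v y w] ad[of w x y z v] ad[of w x z y v] ad[of w x v y z] ad[of v x y z w] ad[of v x z y w] ad[of v x w y z]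
      by simp
    finally show ?thesis .
  qed
  ultimately show "ext_d br (trace_square g e (curvature br D)) xs = 0"
    unfolding xs ext_d_lists R_def[symmetric]
    by (simp only: of_real_diff[symmetric] of_real_add[symmetric] of_real_minus[symmetric] of_real_eq_0_iff) simp
qed

section \<open>Types of forms, and evaluation of \<open>del\<close> and
  \<open>delbar\<close>\<close>

text \<open>Pullback along J respects shuffles, so eigenvalues multiply. Each factor of type (1,0)
  contributes \<i> and each conjugate factor contributes -\<i>.\<close>

lemma wedge_map:
  assumes "\<And>xs. \<alpha> (map J xs) = u * \<alpha> xs" "\<And>xs. \<beta> (map J xs) = v * \<beta> xs"
  shows "(\<alpha> \<and>\<^sub>f \<beta>) (map J xs) = u * v * (\<alpha> \<and>\<^sub>f \<beta>) xs"
  unfolding wedge_def nths_map assms sum_distrib_left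
  by (simp add: mult_ac)

lemma forms10_map:
  assumes "\<alpha> \<in> forms10 J"
  shows "\<alpha> (map J xs) = \<i> * \<alpha> xs"
proof (cases "length xs = 1")
  case True
  then obtain x where "xs = [x]" by (auto simp: length_Suc_conv)
  then show ?thesis using assms by (simp add: forms10_def)
qed (use assms in \<open>auto simp: forms10_def\<close>)

lemma wedge_list_map:
  assumes "set as \<subseteq> forms10 J" "set bs \<subseteq> forms10 J"
  shows "wedge_list (as @ map conj_form bs) (map J xs)
    = \<i> ^ length as * (- \<i>) ^ length bs * wedge_list (as @ map conj_form bs) xs"
  using assms(1)
proof (induction as arbitrary: xs)
  case Nil
  show ?case using assms(2)
  proof (induction bs arbitrary: xs)
    case Nil
    show ?case by (simp add: wedge_list_def unit_form_def)
  next
    case (Cons b bs)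
    have 1: "conj_form b (map J ys) = - \<i> * conj_form b ys" for ys
      using Cons.prems forms10_map[of b J ys] by (simp add: conj_form_def)
    have 2: "foldr wedge (map conj_form bs) unit_form (map J ys)
        = (- \<i>) ^ length bs * foldr wedge (map conj_form bs) unit_form ys" for ys
      using Cons by (simp add: wedge_list_def)
    show ?case using wedge_map[where \<alpha> = "conj_form b" and \<beta> = "foldr wedge (map conj_form bs) unit_form", OF 1 2] by (simp add: wedge_list_def)
  qed
next
  case (Cons a as)
  have 1: "a (map J ys) = \<i> * a ys" for ys
    using Cons.prems forms10_map[of a J ys] by simp
  have 2: "foldr wedge (as @ map conj_form bs) unit_form (map J ys)
      = \<i> ^ length as * (- \<i>) ^ length bs * foldr wedge (as @ map conj_form bs) unit_form ys" for ys
    using Cons by (simp add: wedge_list_def)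
  show ?case using wedge_map[where \<alpha> = a and \<beta> = "foldr wedge (as @ map conj_form bs) unit_form", OF 1 2] by (simp add: wedge_list_def mult.assoc)
qed

lemma forms_pq_map:
  assumes "\<alpha> \<in> forms_pq J p q"
  shows "\<alpha> (map J xs) = \<i> ^ p * (- \<i>) ^ q * \<alpha> xs"
  using assms by induction (auto simp: wedge_list_map algebra_simps)

text \<open>Pullback by \<open>J\<close> has opposite eigenvalues on the two types.\<close>

lemma forms_pq_decomposition_unique:
  assumes "\<beta> \<in> forms_pq J (p + 1) q" "\<gamma> \<in> forms_pq J p (q + 1)"
    and "\<beta>' \<in> forms_pq J (p + 1) q" "\<gamma>' \<in> forms_pq J p (q + 1)"
    and eq: "(\<lambda>xs. \<beta> xs + \<gamma> xs) = (\<lambda>xs. \<beta>' xs + \<gamma>' xs)"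
  shows "\<beta> = \<beta>'" "\<gamma> = \<gamma>'"
proof -
  have "\<beta> xs = \<beta>' xs \<and> \<gamma> xs = \<gamma>' xs" for xs
  proof -
    let ?u = "\<i> ^ (p + 1) * (- \<i>) ^ q :: complex"
    have u: "\<i> ^ p * (- \<i>) ^ (q + 1) = - ?u" by simp
    have 1: "\<beta> xs + \<gamma> xs = \<beta>' xs + \<gamma>' xs" using fun_cong[OF eq] .
    have "\<beta> (map J xs) + \<gamma> (map J xs) = \<beta>' (map J xs) + \<gamma>' (map J xs)" using fun_cong[OF eq] .
    then have "?u * (\<beta> xs - \<gamma> xs) = ?u * (\<beta>' xs - \<gamma>' xs)"
      unfolding forms_pq_map[OF assms(1)] forms_pq_map[OF assms(2)] forms_pq_map[OF assms(3)]
        forms_pq_map[OF assms(4)] u by (simp add: algebra_simps)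
    then have 2: "\<beta> xs - \<gamma> xs = \<beta>' xs - \<gamma>' xs" by simp
    have "2 * \<beta> xs = (\<beta> xs + \<gamma> xs) + (\<beta> xs - \<gamma> xs)" by simp
    also have "\<dots> = 2 * \<beta>' xs" unfolding 1 2 by simp
    finally show ?thesis using 1 by simp
  qed
  then show "\<beta> = \<beta>'" "\<gamma> = \<gamma>'" by auto
qed

text \<open>Uniqueness of the decomposition makes the definite description computable: it is enough
  to exhibit both components of the derivative.\<close>

lemma del_eqI:
  assumes "\<beta> \<in> forms_pq J (p + 1) q" "\<gamma> \<in> forms_pq J p (q + 1)"
    and "ext_d br \<alpha> = (\<lambda>xs. \<beta> xs + \<gamma> xs)"
  shows "del br J p q \<alpha> = \<beta>"
  unfolding del_def
proof (rule the_equality)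
  fix \<delta>
  assume "\<delta> \<in> forms_pq J (p + 1) q \<and>
    (\<exists>\<epsilon>\<in>forms_pq J p (q + 1). ext_d br \<alpha> = (\<lambda>xs. \<delta> xs + \<epsilon> xs))"
  then show "\<delta> = \<beta>"
    using forms_pq_decomposition_unique(1)[OF _ _ assms(1,2)] assms(3) by metis
qed (use assms in blast)

lemma delbar_eqI:
  assumes "\<beta> \<in> forms_pq J (p + 1) q" "\<gamma> \<in> forms_pq J p (q + 1)"
    and "ext_d br \<alpha> = (\<lambda>xs. \<beta> xs + \<gamma> xs)"
  shows "delbar br J p q \<alpha> = \<gamma>"
  unfolding delbar_def
proof (rule the_equality)
  fix \<delta>
  assume "\<delta> \<in> forms_pq J p (q + 1) \<and>
    (\<exists>\<epsilon>\<in>forms_pq J (p + 1) q. ext_d br \<alpha> = (\<lambda>xs. \<epsilon> xs + \<delta> xs))"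
  then show "\<delta> = \<gamma>"
    using forms_pq_decomposition_unique(2)[OF _ _ assms(1,2)] assms(3) by metis
qed (use assms in blast)

lemma forms_pq_add:
  assumes "\<alpha> \<in> forms_pq J p q" "\<beta> \<in> forms_pq J p q"
  shows "(\<lambda>xs. \<alpha> xs + \<beta> xs) \<in> forms_pq J p q"
  using assms(2)
proof induction
  case (add \<beta> as bs c)
  then show ?case using forms_pq.add[of "\<lambda>xs. \<alpha> xs + \<beta> xs" J p q as bs c] by (simp add: add.assoc)
qed (use assms in simp)

lemma forms_pq_scale:
  assumes "\<alpha> \<in> forms_pq J p q"
  shows "(\<lambda>xs. k * \<alpha> xs) \<in> forms_pq J p q"
  using assms
proof induction
  case (add \<alpha> as bs c)
  then show ?case using forms_pq.add[of "\<lambda>xs. k * \<alpha> xs" J p q as bs "k * c"]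
    by (simp add: algebra_simps)
qed (simp add: forms_pq.zero)

lemma forms_pq_diff:
  assumes "\<alpha> \<in> forms_pq J p q" "\<beta> \<in> forms_pq J p q"
  shows "(\<lambda>xs. \<alpha> xs - \<beta> xs) \<in> forms_pq J p q"
  using forms_pq_add[OF assms(1) forms_pq_scale[OF assms(2), of "-1"]] by simp

lemma forms_pq_if:
  "\<alpha> \<in> forms_pq J p q \<Longrightarrow> (\<lambda>xs. if P then \<alpha> xs else 0) \<in> forms_pq J p q"
  by (cases P) (simp_all add: forms_pq.zero)

lemma forms_pq_sum:
  assumes "\<And>i. i \<in> S \<Longrightarrow> \<alpha> i \<in> forms_pq J p q"
  shows "(\<lambda>xs. \<Sum>i\<in>S. \<alpha> i xs) \<in> forms_pq J p q"
  using assms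
  by (induction S rule: infinite_finite_induct) (auto simp: forms_pq.zero forms_pq_add)

lemma homogeneous_forms10: "\<alpha> \<in> forms10 J \<Longrightarrow> homogeneous 1 \<alpha>"
  by (simp add: forms10_def homogeneous_def)

lemma homogeneous_conj_form: "homogeneous p \<alpha> \<Longrightarrow> homogeneous p (conj_form \<alpha>)"
  by (simp add: conj_form_def homogeneous_def)

lemma wedge_unit_form: "\<alpha> \<and>\<^sub>f unit_form = \<alpha>"
proof
  fix xs
  show "(\<alpha> \<and>\<^sub>f unit_form) xs = \<alpha> xs"
  proof (induction xs arbitrary: \<alpha>)
    case (Cons x xs)
    have "(\<lambda>ys. unit_form (x # ys)) = (\<lambda>_. 0)" by (simp add: unit_form_def)
    then have "((\<lambda>ys. (-1) ^ length ys * \<alpha> ys) \<and>\<^sub>f (\<lambda>ys. unit_form (x # ys))) xs = 0"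
      by (simp add: wedge_def)
    then show ?case using Cons by (simp add: wedge_Cons)
  qed (simp add: wedge_Nil unit_form_def)
qed

lemma forms_pq_generator:
  assumes "set as \<subseteq> forms10 J" "set bs \<subseteq> forms10 J"
  shows "wedge_list (as @ map conj_form bs) \<in> forms_pq J (length as) (length bs)"
  using forms_pq.add[OF forms_pq.zero refl refl assms, of 1] by simp

lemma forms_pq_wedge:
  assumes "a \<in> forms10 J" "b \<in> forms10 J" "c \<in> forms10 J"
  shows "a \<and>\<^sub>f b \<and>\<^sub>f conj_form c \<in> forms_pq J 2 1"
    and "a \<and>\<^sub>f conj_form b \<and>\<^sub>f conj_form c \<in> forms_pq J 1 2"
    and "d \<in> forms10 J \<Longrightarrow> a \<and>\<^sub>f b \<and>\<^sub>f conj_form c \<and>\<^sub>f conj_form d \<in> forms_pq J 2 2"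
  using forms_pq_generator[of "[a, b]" J "[c]"] forms_pq_generator[of "[a]" J "[b, c]"]
    forms_pq_generator[of "[a, b]" J "[c, d]"] assms
  by (simp_all add: wedge_list_def wedge_unit_form numeral_2_eq_2)

section \<open>Forms annihilated by contraction with brackets\<close>

text \<open>Only the first argument is restricted, since that is where \<open>ext_d\<close> inserts
  the bracket. The condition implies closedness and, unlike closedness, passes to wedge products
  without a Leibniz rule.\<close>

definition kills_brackets :: "('g \<Rightarrow> 'g \<Rightarrow> 'g) \<Rightarrow> 'g form \<Rightarrow> bool" where
  "kills_brackets br \<alpha> \<longleftrightarrow> (\<forall>x y zs. \<alpha> (br x y # zs) = 0)"

lemma kills_brackets_wedge:
  assumes "kills_brackets br \<alpha>" "kills_brackets br \<beta>"
  shows "kills_brackets br (\<alpha> \<and>\<^sub>f \<beta>)"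
proof -
  have "(\<lambda>ys. \<alpha> (br x y # ys)) = (\<lambda>_. 0)" "(\<lambda>ys. \<beta> (br x y # ys)) = (\<lambda>_. 0)" for x y
    using assms by (simp_all add: kills_brackets_def)
  then show ?thesis by (simp add: kills_brackets_def wedge_Cons) (simp add: wedge_def)
qed

lemma kills_brackets_conj_form: "kills_brackets br \<alpha> \<Longrightarrow> kills_brackets br (conj_form \<alpha>)"
  by (simp add: kills_brackets_def conj_form_def)

lemma ext_d_kills_brackets: "kills_brackets br \<alpha> \<Longrightarrow> ext_d br \<alpha> = (\<lambda>_. 0)"
  by (simp add: kills_brackets_def ext_d_def fun_eq_iff split_def)

lemma closed_one_form_kills_brackets:
  assumes "homogeneous 1 \<alpha>" "ext_d br \<alpha> = (\<lambda>_. 0)"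
  shows "kills_brackets br \<alpha>"
  unfolding kills_brackets_def
proof (intro allI)
  fix x y and zs :: "'a list"
  show "\<alpha> (br x y # zs) = 0"
  proof (cases zs)
    case Nil
    then show ?thesis using fun_cong[OF assms(2), of "[x, y]"] by (simp add: ext_d_lists)
  qed (simp add: homogeneousD[OF assms(1)])
qed

lemma ext_d_add: "ext_d br (\<lambda>xs. \<alpha> xs + \<beta> xs) xs = ext_d br \<alpha> xs + ext_d br \<beta> xs"
  unfolding ext_d_def sum.distrib[symmetric] by (simp add: split_def algebra_simps)

lemma ext_d_diff: "ext_d br (\<lambda>xs. \<alpha> xs - \<beta> xs) xs = ext_d br \<alpha> xs - ext_d br \<beta> xs"
  unfolding ext_d_def sum_subtractf[symmetric] by (simp add: split_def algebra_simps)

lemma ext_d_scale: "ext_d br (\<lambda>xs. k * \<alpha> xs) xs = k * ext_d br \<alpha> xs"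
  unfolding ext_d_def sum_distrib_left by (simp add: split_def algebra_simps)

lemma ext_d_sum: "ext_d br (\<lambda>xs. \<Sum>i\<in>S. \<alpha> i xs) xs = (\<Sum>i\<in>S. ext_d br (\<alpha> i) xs)"
  by (induction S rule: infinite_finite_induct) (simp_all add: ext_d_add, simp_all add: ext_d_def)

section \<open>The conservation law along a flow with closed right-hand side\<close>

text \<open>Nonvanishing is all that is needed of the determinant: the real \<open>sqrt\<close> is
  zero only at 0, so it already makes \<open>norm_Psi h\<close> nonzero.\<close>

lemma pos_def_hermitian_det:
  fixes h :: "complex^3^3"
  assumes "pos_def_hermitian h"
  shows "Re (det h) \<noteq> 0"
proof -
  have herm: "h $ l $ j = cnj (h $ j $ l)" for j l
    using assms unfolding pos_def_hermitian_def by blast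
  \<comment> \<open>The transpose arises because the unconjugated vector is paired with the first
    index of \<open>h\<close>.\<close>
  have "v = 0" if "transpose h *v v = 0" for v
  proof (rule ccontr)
    assume "v \<noteq> 0"
    have "(\<Sum>j\<in>UNIV. \<Sum>l\<in>UNIV. h $ j $ l * v $ j * cnj (v $ l))
        = (\<Sum>l\<in>UNIV. (transpose h *v v) $ l * cnj (v $ l))"
      by (subst sum.swap) (simp add: matrix_vector_mult_def transpose_def sum_distrib_right)
    also have "\<dots> = 0" using that by simp
    finally have "(\<Sum>j\<in>UNIV. \<Sum>l\<in>UNIV. h $ j $ l * v $ j * cnj (v $ l)) = 0" .
    moreover have "Re (\<Sum>j\<in>UNIV. \<Sum>l\<in>UNIV. h $ j $ l * v $ j * cnj (v $ l)) > 0"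
      using assms \<open>v \<noteq> 0\<close> unfolding pos_def_hermitian_def by blast
    ultimately show False by (simp only: zero_complex.simps less_irrefl)
  qed
  then have "det (transpose h) \<noteq> 0"
    by (metis invertible_det_nz invertible_left_inverse matrix_left_invertible_ker)
  \<comment> \<open>Since transposition preserves the determinant, this says that
    \<open>det h\<close> is real, so a nonzero determinant has nonzero real part.\<close>
  moreover have "cnj (det h) = det (transpose h)"
    unfolding det_3 transpose_def
    using herm[of 1 2] herm[of 1 3] herm[of 2 3] herm[of 1 1, symmetric]
      herm[of 2 2, symmetric] herm[of 3 3, symmetric]
    by simp
  ultimately show ?thesis
    by (auto simp: complex_eq_iff)
qed

lemma norm_Psi_nonzero: "pos_def_hermitian h \<Longrightarrow> norm_Psi h \<noteq> 0"
  by (simp add: norm_Psi_def pos_def_hermitian_det)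

text \<open>On a fixed argument list \<open>ext_d\<close> is a finite linear combination of values
  of the form, so it commutes with the time derivative.\<close>

lemma form_derivative_ext_d:
  assumes "form_derivative \<phi> \<phi>' t I"
  shows "((\<lambda>s. ext_d br (\<phi> s) xs) has_vector_derivative ext_d br \<phi>' xs) (at t within I)"
  unfolding ext_d_def
proof (rule has_vector_derivative_sum)
  fix p :: "nat \<times> nat"
  obtain i j where p: "p = (i, j)" by force
  have "((\<lambda>s. \<phi> s ys) has_vector_derivative \<phi>' ys) (at t within I)" for ys
    using assms by (simp add: form_derivative_def)
  from has_vector_derivative_mult_right[OF this]
  show "((\<lambda>s. case p of (i, j) \<Rightarrow> (-1) ^ (i + j) * \<phi> s (br (xs ! i) (xs ! j) # nths xs (- {i, j})))
    has_vector_derivative (case p of (i, j) \<Rightarrow> (-1) ^ (i + j) * \<phi>' (br (xs ! i) (xs ! j) # nths xs (- {i, j}))))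
    (at t within I)"
    unfolding p by simp
qed

lemma balanced_preserved:
  assumes I: "flow_interval I" and pos: "\<And>t. t \<in> I \<Longrightarrow> pos_def_hermitian (h t)"
    and flow: "\<And>t. t \<in> I \<Longrightarrow> \<exists>\<phi>'. form_derivative
      (\<lambda>s xs. norm_Psi (h s) * (fund_form \<zeta> (h s) \<and>\<^sub>f fund_form \<zeta> (h s)) xs) \<phi>' t I
      \<and> ext_d br \<phi>' = (\<lambda>_. 0)"
    and "balanced br (fund_form \<zeta> (h 0))" and t: "t \<in> I"
  shows "balanced br (fund_form \<zeta> (h t))"
  unfolding balanced_def
proof
  fix xs
  let ?d = "\<lambda>s. ext_d br (\<lambda>xs. norm_Psi (h s) * (fund_form \<zeta> (h s) \<and>\<^sub>f fund_form \<zeta> (h s)) xs) xs"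
  have "0 \<in> I" using I by (simp add: flow_interval_def)
  have "(?d has_vector_derivative 0) (at s within I)" if "s \<in> I" for s
  proof -
    obtain \<phi>' where \<phi>': "form_derivative
        (\<lambda>s xs. norm_Psi (h s) * (fund_form \<zeta> (h s) \<and>\<^sub>f fund_form \<zeta> (h s)) xs) \<phi>' s I"
      "ext_d br \<phi>' = (\<lambda>_. 0)"
      using flow \<open>s \<in> I\<close> by blast
    show ?thesis using form_derivative_ext_d[OF \<phi>'(1), of br xs] \<phi>'(2) by simp
  qed
  \<comment> \<open>Derivatives are taken within \<open>I\<close>, so endpoints are included, and
    convexity makes a function with zero derivative constant on \<open>I\<close>.\<close>
  moreover have "convex I" using I by (auto simp: flow_interval_def is_interval_convex)
  ultimately obtain c where "\<And>s. s \<in> I \<Longrightarrow> ?d s = c"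
    using has_vector_derivative_zero_constant by blast
  then have "?d t = ?d 0" using t \<open>0 \<in> I\<close> by simp
  then show "ext_d br (fund_form \<zeta> (h t) \<and>\<^sub>f fund_form \<zeta> (h t)) xs = 0"
    using assms(4) norm_Psi_nonzero[OF pos[OF t]] by (simp add: ext_d_scale balanced_def)
qed

section \<open>The symmetric bilinear form of a fundamental form\<close>

text \<open>Since \<zeta>(J y) = \<i> \<zeta>(y), the factor \<i>/2 turns the alternating product
  into a sum that is symmetric in x and y for each pair j, l. The symmetry of the metric can be read
  off from it.\<close>

lemma fund_form_J_right:
  assumes "\<And>j. \<zeta> j \<in> forms10 J"
  shows "fund_form \<zeta> h [x, J y] = (\<Sum>j\<in>UNIV. \<Sum>l\<in>UNIV. h $ j $ l *
      (\<zeta> j [x] * cnj (\<zeta> l [y]) + \<zeta> j [y] * cnj (\<zeta> l [x]))) / 2"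
proof -
  have J: "\<zeta> j [J y] = \<i> * \<zeta> j [y]" and hom: "homogeneous 1 (\<zeta> j)" for j y
    using assms[of j] by (auto simp: forms10_def homogeneous_def)
  show ?thesis
    unfolding fund_form_def wedge_one_form[OF hom] conj_form_def J sum_distrib_left sum_divide_distrib
    by (intro sum.cong refl) (simp add: algebra_simps)
qed

lemma metric_of_fund_form_commute:
  assumes "\<And>j. \<zeta> j \<in> forms10 J"
  shows "metric_of J (fund_form \<zeta> h) x y = metric_of J (fund_form \<zeta> h) y x"
  unfolding metric_of_def fund_form_J_right[OF assms] by (subst add.commute) (rule refl)

lemma bilinear_metric_of_fund_form:
  assumes "\<And>j. \<zeta> j \<in> forms10 J"
  shows "bilinear (metric_of J (fund_form \<zeta> h))"
proof -
  have lin: "linear (\<lambda>x. \<zeta> j [x])" for j using assms[of j] by (simp add: forms10_def)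
  have "linear (\<lambda>x. fund_form \<zeta> h [x, J y])" for y
  proof (rule linearI)
    fix u v
    show "fund_form \<zeta> h [u + v, J y] = fund_form \<zeta> h [u, J y] + fund_form \<zeta> h [v, J y]"
      unfolding fund_form_J_right[OF assms] linear_add[OF lin] add_divide_distrib[symmetric]
        sum.distrib[symmetric]
      by (intro arg_cong2[of _ _ _ _ "(/)"] sum.cong refl) (simp add: algebra_simps)
  next
    fix c v
    show "fund_form \<zeta> h [c *\<^sub>R v, J y] = c *\<^sub>R fund_form \<zeta> h [v, J y]"
      unfolding fund_form_J_right[OF assms] linear_cmul[OF lin] scaleR_conv_of_real
        times_divide_eq_right sum_distrib_left
      by (intro arg_cong2[of _ _ _ _ "(/)"] sum.cong refl) (simp add: algebra_simps)
  qed
  from linear_compose[OF this bounded_linear.linear[OF bounded_linear_Re]]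
  have "linear (\<lambda>x. metric_of J (fund_form \<zeta> h) x y)" for y
    by (simp add: metric_of_def o_def)
  moreover from this have "linear (metric_of J (fund_form \<zeta> h) y)" for y
    unfolding metric_of_fund_form_commute[OF assms, where h = h and x = y] .
  ultimately show ?thesis by (simp add: bilinear_def)
qed

section \<open>Structure equations and the computation of \<open>i_ddbar\<close>\<close>

text \<open>Normal form for polynomials in the values of the coframe; these rules are used under
  \<open>simp only\<close>.\<close>

lemmas ring_norm = algebra_simps mult_minus_left mult_minus_right minus_add_distrib minus_diff_eq minus_minus
  mult_zero_left mult_zero_right add_0_left add_0_right diff_0 diff_0_right minus_zero

text \<open>In the index type \<open>3\<close> the numeral 3 denotes 0, and it is still distinct
  from 1 and 2. The facts serve as side conditions of \<open>at_bracket\<close> under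
  \<open>simp only\<close>.\<close>

lemma one_neq_three_3: "(1 :: 3) \<noteq> 3" and two_neq_three_3: "(2 :: 3) \<noteq> 3"
  by simp_all

locale nil_coframe =
  fixes br :: "'g::euclidean_space \<Rightarrow> 'g \<Rightarrow> 'g" and J :: "'g \<Rightarrow> 'g" and \<zeta> :: "3 \<Rightarrow> 'g form"
    and \<rho> l :: real and D :: complex
  assumes forms10: "\<zeta> j \<in> forms10 J"
    and closed: "ext_d br (\<zeta> 1) = (\<lambda>_. 0)" "ext_d br (\<zeta> 2) = (\<lambda>_. 0)"
    and structure_eq: "ext_d br (\<zeta> 3) = (\<lambda>xs. \<rho> * (\<zeta> 1 \<and>\<^sub>f \<zeta> 2) xs
           + (\<zeta> 1 \<and>\<^sub>f conj_form (\<zeta> 1)) xs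
           + l * (\<zeta> 1 \<and>\<^sub>f conj_form (\<zeta> 2)) xs
           + D * (\<zeta> 2 \<and>\<^sub>f conj_form (\<zeta> 2)) xs)"
begin

lemma hom: "homogeneous 1 (\<zeta> j)" "homogeneous 1 (conj_form (\<zeta> j))"
  using forms10 homogeneous_forms10 homogeneous_conj_form by blast+

lemma kills: "j \<noteq> 3 \<Longrightarrow> kills_brackets br (\<zeta> j)" "j \<noteq> 3 \<Longrightarrow> kills_brackets br (conj_form (\<zeta> j))"
  using closed_one_form_kills_brackets[OF hom(1) closed(1)]
    closed_one_form_kills_brackets[OF hom(1) closed(2)] exhaust_3[of j] kills_brackets_conj_form
  by auto

lemma at_bracket: "j \<noteq> 3 \<Longrightarrow> \<zeta> j [br x y] = 0"
  using kills(1) by (simp add: kills_brackets_def)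

lemma at_bracket_3: "\<zeta> 3 [br x y] = - (\<rho> * (\<zeta> 1 [x] * \<zeta> 2 [y] - \<zeta> 1 [y] * \<zeta> 2 [x])
    + (\<zeta> 1 [x] * cnj (\<zeta> 1 [y]) - \<zeta> 1 [y] * cnj (\<zeta> 1 [x]))
    + l * (\<zeta> 1 [x] * cnj (\<zeta> 2 [y]) - \<zeta> 1 [y] * cnj (\<zeta> 2 [x]))
    + D * (\<zeta> 2 [x] * cnj (\<zeta> 2 [y]) - \<zeta> 2 [y] * cnj (\<zeta> 2 [x])))"
proof -
  have "\<zeta> 3 [br x y] = - ext_d br (\<zeta> 3) [x, y]" by (simp add: ext_d_lists)
  then show ?thesis unfolding structure_eq wedge_one_form[OF hom(1)] conj_form_def .
qed

text \<open>With \<open>part12\<close> below: the two type components of d\<zeta>^j \<and> conj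
  \<zeta>^k - \<zeta>^j \<and> d(conj \<zeta>^k). In the second term the conjugated structure
  equation produces products conj \<zeta>^a \<and> \<zeta>^b; reordering them absorbs the minus sign
  here, while the \<rho> term of \<open>part12\<close> keeps it.\<close>

definition part21 :: "3 \<Rightarrow> 3 \<Rightarrow> 'g form" where
  "part21 j k xs = (if j = 3 then \<rho> * (\<zeta> 1 \<and>\<^sub>f \<zeta> 2 \<and>\<^sub>f conj_form (\<zeta> k)) xs else 0)
     + (if k = 3 then (\<zeta> j \<and>\<^sub>f \<zeta> 1 \<and>\<^sub>f conj_form (\<zeta> 1)) xs
          + l * (\<zeta> j \<and>\<^sub>f \<zeta> 2 \<and>\<^sub>f conj_form (\<zeta> 1)) xs
          + cnj D * (\<zeta> j \<and>\<^sub>f \<zeta> 2 \<and>\<^sub>f conj_form (\<zeta> 2)) xs else 0)"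

definition part12 :: "3 \<Rightarrow> 3 \<Rightarrow> 'g form" where
  "part12 j k xs = (if j = 3 then (\<zeta> 1 \<and>\<^sub>f conj_form (\<zeta> 1) \<and>\<^sub>f conj_form (\<zeta> k)) xs
          + l * (\<zeta> 1 \<and>\<^sub>f conj_form (\<zeta> 2) \<and>\<^sub>f conj_form (\<zeta> k)) xs
          + D * (\<zeta> 2 \<and>\<^sub>f conj_form (\<zeta> 2) \<and>\<^sub>f conj_form (\<zeta> k)) xs else 0)
     - (if k = 3 then \<rho> * (\<zeta> j \<and>\<^sub>f conj_form (\<zeta> 1) \<and>\<^sub>f conj_form (\<zeta> 2)) xs else 0)"

lemma part21_in: "part21 j k \<in> forms_pq J 2 1"
  unfolding part21_def[abs_def]
  by (intro forms_pq_add forms_pq_if forms_pq_scale forms_pq_wedge forms10)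

lemma part12_in: "part12 j k \<in> forms_pq J 1 2"
  unfolding part12_def[abs_def]
  by (intro forms_pq_diff forms_pq_add forms_pq_if forms_pq_scale forms_pq_wedge forms10)

lemma homogeneous_triple:
  assumes "homogeneous 1 a" "homogeneous 1 b" "homogeneous 1 c"
  shows "homogeneous 3 (a \<and>\<^sub>f b \<and>\<^sub>f c)"
  using homogeneous_wedge[OF assms(1) homogeneous_wedge[OF assms(2,3)]] by (simp add: numeral_3_eq_3)

lemmas triples = homogeneous_triple[OF hom(1) hom(1) hom(2), THEN homogeneousD]
  homogeneous_triple[OF hom(1) hom(2) hom(2), THEN homogeneousD]

lemma ext_d_wedge: "ext_d br (\<zeta> j \<and>\<^sub>f conj_form (\<zeta> k)) = (\<lambda>xs. part21 j k xs + part12 j k xs)"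
proof
  fix xs
  show "ext_d br (\<zeta> j \<and>\<^sub>f conj_form (\<zeta> k)) xs = part21 j k xs + part12 j k xs"
  proof (cases "length xs = 3")
    case False
    then have "ext_d br (\<zeta> j \<and>\<^sub>f conj_form (\<zeta> k)) xs = 0"
      using homogeneousD[OF homogeneous_ext_d[OF homogeneous_wedge[OF hom(1) hom(2)]], of xs] by simp
    with False show ?thesis by (simp add: part21_def part12_def triples)
  next
    case True
    then obtain x y z where xs: "xs = [x, y, z]" by (auto simp: length_Suc_conv numeral_3_eq_3)
    show ?thesis
      unfolding xs ext_d_lists wedge_one_form[OF hom(1)] part21_def part12_def
      by (cases "j = 3"; cases "k = 3";
        simp only: wedge_one_form[OF hom(1)] wedge_one_form[OF hom(2)] conj_form_def at_bracket
          at_bracket_3 if_True if_False complex_cnj_add complex_cnj_diff complex_cnj_minus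
          complex_cnj_mult complex_cnj_cnj complex_cnj_complex_of_real complex_cnj_zero
          of_real_minus of_real_mult mult_zero_left mult_zero_right
          not_False_eq_True refl ring_norm)
  qed
qed

lemma kills_vol_12: "kills_brackets br (vol_12 \<zeta>)"
  unfolding vol_12_def by (intro kills_brackets_wedge kills) auto

lemma homogeneous_vol_12: "homogeneous 4 (vol_12 \<zeta>)"
  using homogeneous_wedge[OF hom(1)[of 1] homogeneous_triple[OF hom(1)[of 2] hom(2)[of 1] hom(2)[of 2]]]
  by (simp add: vol_12_def)

lemma homogeneous_part12: "homogeneous 3 (part12 j k)"
  by (simp add: homogeneous_def part12_def triples)

text \<open>Only complementary factors survive: the (1, conj 1) term meets the (2, conj 2) term of
  the conjugated equation and gives \<open>cnj D\<close>, the reverse pairing gives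
  \<open>D\<close>, the (1, conj 2) term meets the conjugate of itself and gives -l^2, and the
  \<rho> term gives -\<rho>^2.\<close>

lemma ext_d_part12_3_3: "ext_d br (part12 3 3) = (\<lambda>xs. (D + cnj D - l * l - \<rho> * \<rho>) * vol_12 \<zeta> xs)"
proof
  fix xs
  show "ext_d br (part12 3 3) xs = (D + cnj D - l * l - \<rho> * \<rho>) * vol_12 \<zeta> xs"
  proof (cases "length xs = 4")
    case False
    then show ?thesis
      by (simp add: homogeneousD[OF homogeneous_ext_d[OF homogeneous_part12]]
          homogeneousD[OF homogeneous_vol_12])
  next
    case True
    then obtain x y z w where xs: "xs = [x, y, z, w]" by (auto simp: length_Suc_conv numeral_eq_Suc)
    show ?thesis
      unfolding xs ext_d_lists part12_def vol_12_def
      by (simp only: wedge_one_form[OF hom(1)] wedge_one_form[OF hom(2)] conj_form_def at_bracket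
          at_bracket_3 if_True if_False complex_cnj_add complex_cnj_diff complex_cnj_minus
          complex_cnj_mult complex_cnj_cnj complex_cnj_complex_of_real complex_cnj_zero
          of_real_minus of_real_mult mult_zero_left mult_zero_right
          not_False_eq_True refl one_neq_three_3 two_neq_three_3 ring_norm)
  qed
qed

text \<open>Unless both indices are 3, every product that remains in \<open>part12 j k\<close> is
  built from \<zeta>^1, \<zeta>^2 and their conjugates, so it is closed.\<close>

lemma ext_d_part12:
  "ext_d br (part12 j k)
    = (\<lambda>xs. (if j = 3 \<and> k = 3 then D + cnj D - l * l - \<rho> * \<rho> else 0) * vol_12 \<zeta> xs)"
proof (cases "j = 3 \<and> k = 3")
  case False
  have "kills_brackets br (part12 j k)"
    unfolding kills_brackets_def
  proof (intro allI)
    fix x y zs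
    have *: "(\<zeta> i \<and>\<^sub>f conj_form (\<zeta> m) \<and>\<^sub>f conj_form (\<zeta> n)) (br x y # zs) = 0"
      if "i \<noteq> 3" "m \<noteq> 3" "n \<noteq> 3" for i m n
      using kills_brackets_wedge[OF kills(1) kills_brackets_wedge[OF kills(2) kills(2)]] that
      by (simp add: kills_brackets_def)
    show "part12 j k (br x y # zs) = 0"
      using False by (auto simp: part12_def *)
  qed
  then show ?thesis unfolding if_not_P[OF False] by (simp add: ext_d_kills_brackets)
qed (simp add: ext_d_part12_3_3)

lemma i_ddbar_fund_form: "\<exists>K. i_ddbar br J (fund_form \<zeta> h) = (\<lambda>xs. K * vol_12 \<zeta> xs)"
proof -
  define \<beta> where "\<beta> xs = \<i> / 2 * (\<Sum>j\<in>UNIV. \<Sum>k\<in>UNIV. h $ j $ k * part21 j k xs)" for xs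
  define \<gamma> where "\<gamma> xs = \<i> / 2 * (\<Sum>j\<in>UNIV. \<Sum>k\<in>UNIV. h $ j $ k * part12 j k xs)" for xs
  \<comment> \<open>Only the coefficient of \<open>h\<close> at (3, 3) contributes.\<close>
  define K where "K = \<i> / 2 * (\<Sum>j\<in>UNIV. \<Sum>k\<in>UNIV. h $ j $ k *
    (if j = 3 \<and> k = 3 then D + cnj D - l * l - \<rho> * \<rho> else 0))"
  have \<beta>: "\<beta> \<in> forms_pq J (1 + 1) 1" and \<gamma>: "\<gamma> \<in> forms_pq J 1 (1 + 1)"
    unfolding \<beta>_def[abs_def] \<gamma>_def[abs_def] one_add_one
    by (intro forms_pq_scale forms_pq_sum part21_in part12_in)+
  have "ext_d br (fund_form \<zeta> h) = (\<lambda>xs. \<beta> xs + \<gamma> xs)"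
    unfolding fund_form_def[abs_def] \<beta>_def \<gamma>_def fun_eq_iff ext_d_scale ext_d_sum ext_d_wedge
    by (simp add: algebra_simps sum.distrib)
  then have delbar: "delbar br J 1 1 (fund_form \<zeta> h) = \<gamma>"
    by (rule delbar_eqI[OF \<beta> \<gamma>])
  \<comment> \<open>The summand 0 is the component of type (1,3): the derivative of \<gamma> is
    purely of type (2,2), so it equals \<open>del\<close> of \<gamma>.\<close>
  have "ext_d br \<gamma> = (\<lambda>xs. K * vol_12 \<zeta> xs + 0)"
    unfolding \<gamma>_def[abs_def] K_def fun_eq_iff
    unfolding ext_d_scale ext_d_sum ext_d_part12 by (simp add: sum_distrib_right mult.assoc)
  moreover have "(\<lambda>xs. K * vol_12 \<zeta> xs) \<in> forms_pq J (1 + 1) 2"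
    unfolding vol_12_def one_add_one by (intro forms_pq_scale forms_pq_wedge forms10)
  ultimately have "del br J 1 2 \<gamma> = (\<lambda>xs. K * vol_12 \<zeta> xs)"
    by (intro del_eqI[OF _ forms_pq.zero])
  then have "i_ddbar br J (fund_form \<zeta> h) = (\<lambda>xs. \<i> * K * vol_12 \<zeta> xs)"
    unfolding fun_eq_iff i_ddbar_def delbar by simp
  then show ?thesis by blast
qed

end

section \<open>Closed right-hand sides of the two flows\<close>

text \<open>Bilinearity and skewness for the metric are linear conditions on the connection, so they
  pass from the Chern and Bismut connections to the whole Gauduchon line.\<close>

lemma gauduchon_connection_metric:
  assumes "gauduchon_connection br J g \<tau> D" "bilinear g"
  shows "bilinear D" "g (D x y) z + g y (D x z) = 0"
proof -
  let ?a = "(1 + \<tau>) / 2" and ?b = "(1 - \<tau>) / 2"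
  obtain D1 D2 where D1: "hermitian_connection J g D1" and D2: "hermitian_connection J g D2"
    and D: "\<And>x y. D x y = ?a *\<^sub>R D1 x y + ?b *\<^sub>R D2 x y"
    using assms(1) unfolding gauduchon_connection_def chern_connection_def bismut_connection_def by blast
  have b: "bilinear D1" "bilinear D2"
    using D1 D2 by (simp_all add: hermitian_connection_def)
  show "bilinear D"
    unfolding bilinear_def D
    by (intro conjI allI linear_compose_add linear_compose_scale_right)
      (use b in \<open>simp_all add: bilinear_def\<close>)
  have "g (D1 x y) z + g y (D1 x z) = 0" "g (D2 x y) z + g y (D2 x z) = 0"
    using D1 D2 by (simp_all add: hermitian_connection_def)
  then have "?a * (g (D1 x y) z + g y (D1 x z)) + ?b * (g (D2 x y) z + g y (D2 x z)) = 0"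
    by simp
  then show "g (D x y) z + g y (D x z) = 0"
    unfolding D bilinear_ladd[OF assms(2)] bilinear_radd[OF assms(2)] bilinear_lmul[OF assms(2)]
      bilinear_rmul[OF assms(2)] by (simp add: algebra_simps)
qed

lemma ext_d_tangent_trace:
  assumes "lie_bracket br" "\<And>j. \<zeta> j \<in> forms10 J" "is_tangent_trace br J (fund_form \<zeta> h) \<tau> Rm"
  shows "ext_d br Rm = (\<lambda>_. 0)"
proof -
  let ?g = "metric_of J (fund_form \<zeta> h)"
  obtain D e where D: "gauduchon_connection br J ?g \<tau> D" and e: "orthonormal_frame ?g e"
    and Rm: "Rm = trace_square ?g e (curvature br D)"
    using assms(3) unfolding is_tangent_trace_def by blast
  note g = bilinear_metric_of_fund_form[where h = h, OF assms(2)]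
  show ?thesis
    unfolding Rm
    by (rule ext_d_trace_square_curvature[OF assms(1) g metric_of_fund_form_commute[OF assms(2)]
        gauduchon_connection_metric[OF D g] e])
qed

context nil_coframe
begin

lemma ext_d_vol_12: "ext_d br (vol_12 \<zeta>) = (\<lambda>_. 0)"
  by (rule ext_d_kills_brackets[OF kills_vol_12])

lemma ext_d_i_ddbar: "ext_d br (i_ddbar br J (fund_form \<zeta> h)) = (\<lambda>_. 0)"
proof -
  obtain K where K: "i_ddbar br J (fund_form \<zeta> h) = (\<lambda>xs. K * vol_12 \<zeta> xs)"
    using i_ddbar_fund_form by blast
  show ?thesis unfolding K fun_eq_iff ext_d_scale ext_d_vol_12 by simp
qed

lemma flow_F1_balanced:
  assumes "lie_bracket br" "flow_interval I" "flow_F1 br J \<zeta> \<alpha>' \<tau> \<kappa> c I h \<theta> H \<sigma>"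
    and "balanced br (fund_form \<zeta> (h 0))" "t \<in> I"
  shows "balanced br (fund_form \<zeta> (h t))"
proof (rule balanced_preserved[where h = h and t = t, OF assms(2) _ _ assms(4,5)])
  fix s assume s: "s \<in> I"
  then show "pos_def_hermitian (h s)" using assms(3) unfolding flow_F1_def by blast
  obtain Rm F m where Rm: "is_tangent_trace br J (fund_form \<zeta> (h s)) \<tau> Rm"
    and F: "F = (\<lambda>xs. m * vol_12 \<zeta> xs)"
    and deriv: "form_derivative
      (\<lambda>s xs. norm_Psi (h s) * (fund_form \<zeta> (h s) \<and>\<^sub>f fund_form \<zeta> (h s)) xs)
      (\<lambda>xs. i_ddbar br J (fund_form \<zeta> (h s)) xs - complex_of_real \<alpha>' / 4 * (Rm xs - F xs)) s I"
    using assms(3) s unfolding flow_F1_def by blast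
  have "ext_d br (\<lambda>xs. i_ddbar br J (fund_form \<zeta> (h s)) xs - complex_of_real \<alpha>' / 4 * (Rm xs - F xs)) = (\<lambda>_. 0)"
    unfolding fun_eq_iff ext_d_diff ext_d_scale F ext_d_i_ddbar ext_d_vol_12
      ext_d_tangent_trace[OF assms(1) forms10 Rm] by simp
  then show "\<exists>\<phi>'. form_derivative
      (\<lambda>s xs. norm_Psi (h s) * (fund_form \<zeta> (h s) \<and>\<^sub>f fund_form \<zeta> (h s)) xs) \<phi>' s I
      \<and> ext_d br \<phi>' = (\<lambda>_. 0)"
    using deriv by blast
qed

lemma flow_F2_balanced:
  assumes "lie_bracket br" "flow_interval I" "flow_F2 br J \<zeta> \<alpha>' \<tau> I h"
    and "balanced br (fund_form \<zeta> (h 0))" "t \<in> I"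
  shows "balanced br (fund_form \<zeta> (h t))"
proof (rule balanced_preserved[where h = h and t = t, OF assms(2) _ _ assms(4,5)])
  fix s assume s: "s \<in> I"
  then show "pos_def_hermitian (h s)" using assms(3) unfolding flow_F2_def by blast
  obtain Rm where Rm: "is_tangent_trace br J (fund_form \<zeta> (h s)) \<tau> Rm"
    and deriv: "form_derivative
      (\<lambda>s xs. norm_Psi (h s) * (fund_form \<zeta> (h s) \<and>\<^sub>f fund_form \<zeta> (h s)) xs)
      (\<lambda>xs. i_ddbar br J (fund_form \<zeta> (h s)) xs - complex_of_real \<alpha>' / 4 * Rm xs) s I"
    using assms(3) s unfolding flow_F2_def by blast
  have "ext_d br (\<lambda>xs. i_ddbar br J (fund_form \<zeta> (h s)) xs - complex_of_real \<alpha>' / 4 * Rm xs) = (\<lambda>_. 0)"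
    unfolding fun_eq_iff ext_d_diff ext_d_scale ext_d_i_ddbar
      ext_d_tangent_trace[OF assms(1) forms10 Rm] by simp
  then show "\<exists>\<phi>'. form_derivative
      (\<lambda>s xs. norm_Psi (h s) * (fund_form \<zeta> (h s) \<and>\<^sub>f fund_form \<zeta> (h s)) xs) \<phi>' s I
      \<and> ext_d br \<phi>' = (\<lambda>_. 0)"
    using deriv by blast
qed

end

theorem theorem3:
  fixes br :: "'g::euclidean_space \<Rightarrow> 'g \<Rightarrow> 'g"
    and \<Gamma> :: "'g set"
    and J :: "'g \<Rightarrow> 'g"
    and \<zeta> :: "3 \<Rightarrow> 'g form"
    and \<rho> x y l \<alpha>' \<tau> \<kappa> :: real
    and c :: complex
    and \<theta> :: "'r::finite \<Rightarrow> 'r \<Rightarrow> 'g form"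
  assumes "DIM('g) = 6"
    and "two_step_nilpotent br"
    and "cocompact_lattice br \<Gamma>"
    and "betti 1 (nilmanifold br \<Gamma>) \<ge> 4"
    and "complex_structure br J"
    and "\<not> complex_parallelizable br J"
    and "coframe J \<zeta>"
    and "\<rho> \<in> {0, 1}" and "l \<ge> 0"
    and "ext_d br (\<zeta> 1) = (\<lambda>_. 0)"
    and "ext_d br (\<zeta> 2) = (\<lambda>_. 0)"
    and "ext_d br (\<zeta> 3) = (\<lambda>xs. \<rho> * (\<zeta> 1 \<and>\<^sub>f \<zeta> 2) xs
           + (\<zeta> 1 \<and>\<^sub>f conj_form (\<zeta> 1)) xs
           + l * (\<zeta> 1 \<and>\<^sub>f conj_form (\<zeta> 2)) xs
           + Complex x y * (\<zeta> 2 \<and>\<^sub>f conj_form (\<zeta> 2)) xs)"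
  shows "(\<forall>I h H \<sigma>. flow_interval I \<and> flow_F1 br J \<zeta> \<alpha>' \<tau> \<kappa> c I h \<theta> H \<sigma> \<and>
              balanced br (fund_form \<zeta> (h 0)) \<longrightarrow>
            (\<forall>t\<in>I. balanced br (fund_form \<zeta> (h t)))) \<and>
         (\<forall>I h. flow_interval I \<and> flow_F2 br J \<zeta> \<alpha>' \<tau> I h \<and>
              balanced br (fund_form \<zeta> (h 0)) \<longrightarrow>
            (\<forall>t\<in>I. balanced br (fund_form \<zeta> (h t))))"
proof -
  interpret nil_coframe br J \<zeta> \<rho> l "Complex x y"
    using assms(7,10,11,12) by unfold_locales (auto simp: coframe_def)
  have "lie_bracket br" using assms(2) by (simp add: two_step_nilpotent_def)
  then show ?thesis using flow_F1_balanced flow_F2_balanced by blast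
qed

end
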